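(* Let $X$ be a Tychonoff space with $iw(X)=\aleph_0$. Then the following statements are equivalent: (1) $(C(X),\tau_k,\tau_p)$ has the property $S_{fin}(\mathcal{D}^k,\mathcal{D}^p)$; (2) $(C(X),\tau_k,\tau_p)$ has the property $S_{fin}(\mathcal{D}^k,\Omega^p_{\mathbf 0})$; (3) $(C(X),\tau_k,\tau_p)$ has the property $S_{fin}(\Omega^k_{\mathbf 0},\Omega^p_{\mathbf 0})$; (4) $X$ satisfies the selection principle $S_{fin}(\mathcal{K},\Omega)$; (5) ONE has no winning strategy in the game $G_{fin}(\mathcal{K},\Omega)$; (6) ONE has no winning strategy in the game $G_{fin}(\mathcal{D}^k,\mathcal{D}^p)$; (7) ONE has no winning strategy in the game $G_{fin}(\Omega^k_{\mathbf 0},\Omega^p_{\mathbf 0})$; (8) ONE has no winning strategy in the game $G_{fin}(\mathcal{D}^k,\Omega^p_{\mathbf 0})$.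
   Context: For a Tychonoff space $X$, $C(X)$ is the set of all continuous real-valued functions on $X$; $\tau_k$ is the compact-open topology and $\tau_p$ the topology of pointwise convergence on $C(X)$; $C_k(X)=(C(X),\tau_k)$, $C_p(X)=(C(X),\tau_p)$; $(C(X),\tau_k,\tau_p)$ is the resulting bitopological space. $\mathbf 0$ is the constantly zero function. The $i$-weight $iw(X)$ is the smallest infinite cardinal $\tau$ such that $X$ admits a one-to-one continuous mapping onto a Tychonoff space of weight at most $\tau$. Covers are nontrivial: $\mathcal{U}$ is a cover of $X$ if $X=\bigcup\mathcal{U}$ and $X\notin\mathcal{U}$. An open cover $\mathcal{U}$ of $X$ is an $\omega$-cover (respectively, a $k$-cover) if each finite (respectively, compact) subset of $X$ is contained in an element of $\mathcal{U}$. $\Omega$ is the family of all open $\omega$-covers of $X$ and $\mathcal{K}$ is the family of all open $k$-covers of $X$. $\mathcal{D}^k$ (respectively, $\mathcal{D}^p$) is the family of all dense subsets of $C_k(X)$ (respectively, $C_p(X)$). For a point $x$ of a topological space $Y$, $\Omega_x=\{A\subseteq Y: x\in\overline{A}\setminus A\}$; $\Omega^k_{\mathbf 0}$ and $\Omega^p_{\mathbf 0}$ denote $\Omega_{\mathbf 0}$ computed in $C_k(X)$ and in $C_p(X)$, respectively. Let $\mathcal{A},\mathcal{B}$ be families of sets. $S_{fin}(\mathcal{A},\mathcal{B})$: for each sequence $(A_n:n\in\mathbb{N})$ of elements of $\mathcal{A}$ there is a sequence $(B_n:n\in\mathbb{N})$ of finite sets with $B_n\subseteq A_n$ for each $n$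 and $\bigcup_{n\in\mathbb{N}}B_n\in\mathcal{B}$. The game $G_{fin}(\mathcal{A},\mathcal{B})$: players ONE and TWO play a round for each $n\in\mathbb{N}$; in the $n$-th round ONE chooses $A_n\in\mathcal{A}$ and TWO responds with a finite subset $B_n$ of $A_n$. TWO wins the play if $\bigcup_{n\in\mathbb{N}}B_n\in\mathcal{B}$; otherwise ONE wins. A strategy of a player is a function from the set of all finite sequences of moves of the opponent to the set of legal moves of the strategy owner. *)

theory Defs
  imports "HOL-Analysis.Analysis"
begin

unbundle cardinal_syntax

section \<open>Tychonoff spaces, weight and i-weight\<close>

definition tychonoff_space :: "'a topology \<Rightarrow> bool" where
  "tychonoff_space X \<longleftrightarrow> completely_regular_space X \<and> Hausdorff_space X"

definition base_of :: "'a topology \<Rightarrow> 'a set set \<Rightarrow> bool" where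
  "base_of X \<B> \<longleftrightarrow>
     (\<forall>V\<in>\<B>. openin X V) \<and>
     (\<forall>U x. openin X U \<and> x \<in> U \<longrightarrow> (\<exists>V\<in>\<B>. x \<in> V \<and> V \<subseteq> U))"

definition weight :: "'a topology \<Rightarrow> 'a set rel" where
  "weight X =
     (SOME r. \<exists>\<B>. base_of X \<B> \<and> r = |\<B>| \<and> (\<forall>\<B>'. base_of X \<B>' \<longrightarrow> |\<B>| \<le>o |\<B>'| ))"

text \<open>A one-to-one image of a space can be copied onto the underlying set of that space, so
  taking the target space over the same type loses no generality.\<close>

definition condenses_onto_weight_le :: "'a topology \<Rightarrow> 'c rel \<Rightarrow> bool" where
  "condenses_onto_weight_le X \<tau> \<longleftrightarrow>
     (\<exists>(Y :: 'a topology) f.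
        tychonoff_space Y \<and> weight Y \<le>o \<tau> \<and>
        continuous_map X Y f \<and> inj_on f (topspace X) \<and> f ` topspace X = topspace Y)"

text \<open>Cardinals are represented by \<^const>\<open>Card_order\<close> relations, which are compared with
  \<open>\<le>o\<close> and identified up to \<open>=o\<close>. The type \<^typ>\<open>nat + 'a set\<close> is infinite and
  large enough to carry the weight of every topology over \<^typ>\<open>'a\<close>; so when \<open>X\<close> is Tychonoff
  it carries a cardinal as required, and also a copy of every smaller cardinal.\<close>

definition iw :: "'a topology \<Rightarrow> (nat + 'a set) rel" where
  "iw X =
     (SOME \<tau>. Cinfinite \<tau> \<and> condenses_onto_weight_le X \<tau> \<and>
        (\<forall>\<sigma> :: (nat + 'a set) rel. Cinfinite \<sigma> \<and> condenses_onto_weight_le X \<sigma> \<longrightarrow> \<tau> \<le>o \<sigma>))"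

lemma weight_exists:
  "\<exists>\<B>. base_of X \<B> \<and> weight X = |\<B>| \<and> (\<forall>\<B>'. base_of X \<B>' \<longrightarrow> |\<B>| \<le>o |\<B>'| )"
proof -
  let ?R = "{ |\<B>| | \<B>. base_of X \<B> }"
  have "base_of X {U. openin X U}"
    by (auto simp: base_of_def)
  then have "?R \<noteq> {}"
    by blast
  moreover have "\<forall>r\<in>?R. Card_order r"
    by (auto simp: card_of_Card_order)
  ultimately obtain r where "r \<in> ?R" "\<forall>r'\<in>?R. r \<le>o r'"
    using exists_minim_Card_order by meson
  then have "\<exists>r \<B>. base_of X \<B> \<and> r = |\<B>| \<and> (\<forall>\<B>'. base_of X \<B>' \<longrightarrow> |\<B>| \<le>o |\<B>'| )"
    by blast
  then show ?thesis
    unfolding weight_def by (rule someI_ex)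
qed

lemma weight_ordLeq_iff: "weight X \<le>o r \<longleftrightarrow> (\<exists>\<B>. base_of X \<B> \<and> |\<B>| \<le>o r)"
  using weight_exists[of X] by (metis ordLeq_transitive)

lemma countable_iff_ordLeq_natLeq: "countable A \<longleftrightarrow> |A| \<le>o natLeq"
proof -
  have "countable A \<longleftrightarrow> |A| \<le>o |UNIV :: nat set|"
    unfolding countable_def card_of_ordLeq[symmetric] by auto
  then show ?thesis
    using card_of_nat ordIso_symmetric ordLeq_ordIso_trans by blast
qed

lemma second_countable_iff_weight: "second_countable X \<longleftrightarrow> weight X \<le>o natLeq"
  unfolding weight_ordLeq_iff second_countable_def base_of_def countable_iff_ordLeq_natLeq by blast

lemma iw_props:
  fixes X :: "'a topology"
  assumes "tychonoff_space X"
  shows "Cinfinite (iw X) \<and> condenses_onto_weight_le X (iw X) \<and>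
    (\<forall>\<sigma> :: (nat + 'a set) rel. Cinfinite \<sigma> \<and> condenses_onto_weight_le X \<sigma> \<longrightarrow> iw X \<le>o \<sigma>)"
proof -
  let ?R = "{\<tau> :: (nat + 'a set) rel. Cinfinite \<tau> \<and> condenses_onto_weight_le X \<tau>}"
  let ?t = "|UNIV :: (nat + 'a set) set|"
  obtain \<B> where \<B>: "weight X = |\<B>|"
    using weight_exists by blast
  have "inj_on (Inr :: 'a set \<Rightarrow> nat + 'a set) \<B>"
    by (auto simp: inj_on_def)
  then have "|\<B>| \<le>o ?t"
    using card_of_ordLeq[of \<B> "UNIV :: (nat + 'a set) set"] by blast
  then have "condenses_onto_weight_le X ?t"
    unfolding condenses_onto_weight_le_def
    using assms \<B> by (intro exI[of _ X] exI[of _ "\<lambda>x. x"]) auto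
  moreover have "Cinfinite ?t"
    by (simp add: cinfinite_def card_of_card_order_on Field_card_of finite_Plus_UNIV_iff)
  ultimately have "?R \<noteq> {}"
    by blast
  then obtain r where "r \<in> ?R" "\<forall>r'\<in>?R. r \<le>o r'"
    using exists_minim_Card_order[of ?R] by blast
  then have "\<exists>\<tau> :: (nat + 'a set) rel. Cinfinite \<tau> \<and> condenses_onto_weight_le X \<tau> \<and>
      (\<forall>\<sigma> :: (nat + 'a set) rel. Cinfinite \<sigma> \<and> condenses_onto_weight_le X \<sigma> \<longrightarrow> \<tau> \<le>o \<sigma>)"
    by (intro exI[of _ r]) simp
  then show ?thesis
    unfolding iw_def by (rule someI_ex)
qed

lemma condenses_onto_weight_le_mono:
  "condenses_onto_weight_le X r \<Longrightarrow> r \<le>o s \<Longrightarrow> condenses_onto_weight_le X s"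
  unfolding condenses_onto_weight_le_def by (meson ordLeq_transitive)

lemma iw_countable_iff:
  fixes X :: "'a topology"
  assumes "tychonoff_space X"
  shows "iw X =o natLeq \<longleftrightarrow>
    (\<exists>(Y :: 'a topology) f. tychonoff_space Y \<and> second_countable Y \<and>
       continuous_map X Y f \<and> inj_on f (topspace X) \<and> f ` topspace X = topspace Y)"
    (is "?L \<longleftrightarrow> ?R")
proof -
  note iw = iw_props[OF assms]
  have R: "?R \<longleftrightarrow> condenses_onto_weight_le X natLeq"
    by (simp add: condenses_onto_weight_le_def second_countable_iff_weight)
  have "?L" if c: "condenses_onto_weight_le X natLeq"
  proof -
    let ?s = "|range (Inl :: nat \<Rightarrow> nat + 'a set)|"
    have "?s =o |UNIV :: nat set|"
      using card_of_ordIsoI[of "Inl :: nat \<Rightarrow> nat + 'a set" UNIV "range Inl"]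
      by (auto simp: bij_betw_def intro: ordIso_symmetric)
    then have s: "?s =o natLeq"
      using card_of_nat ordIso_transitive by blast
    have "Cinfinite ?s"
      by (simp add: cinfinite_def card_of_card_order_on Field_card_of finite_image_iff)
    moreover have "condenses_onto_weight_le X ?s"
      using c s condenses_onto_weight_le_mono ordIso_iff_ordLeq by blast
    ultimately have "iw X \<le>o ?s"
      using iw by blast
    then have "iw X \<le>o natLeq"
      using s ordLeq_ordIso_trans by blast
    moreover have "natLeq \<le>o iw X"
      using iw by (intro natLeq_ordLeq_cinfinite) auto
    ultimately show ?thesis
      by (simp add: ordIso_iff_ordLeq)
  qed
  moreover have "condenses_onto_weight_le X natLeq" if ?L
    using iw that condenses_onto_weight_le_mono ordIso_iff_ordLeq by blast
  ultimately show ?thesis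
    unfolding R by blast
qed

section \<open>Function spaces\<close>

text \<open>Functions are normalised to \<^const>\<open>undefined\<close> outside \<open>topspace X\<close>, so that equality of
  members of \<open>C(X)\<close> is equality on \<open>X\<close>.\<close>

definition cfun :: "'a topology \<Rightarrow> ('a \<Rightarrow> real) set" where
  "cfun X = {f \<in> extensional (topspace X). continuous_map X euclideanreal f}"

definition zero_fun :: "'a topology \<Rightarrow> 'a \<Rightarrow> real" where
  "zero_fun X = (\<lambda>x\<in>topspace X. 0)"

definition C\<^sub>p :: "'a topology \<Rightarrow> ('a \<Rightarrow> real) topology" where
  "C\<^sub>p X = subtopology (powertop_real (topspace X)) (cfun X)"

definition C\<^sub>k :: "'a topology \<Rightarrow> ('a \<Rightarrow> real) topology" where
  "C\<^sub>k X = topology_generated_by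
     {{f \<in> cfun X. f ` K \<subseteq> U} | K U. compactin X K \<and> open U}"

lemma topspace_C\<^sub>p: "topspace (C\<^sub>p X) = cfun X"
  by (auto simp: C\<^sub>p_def cfun_def PiE_def)

lemma topspace_C\<^sub>k: "topspace (C\<^sub>k X) = cfun X"
proof -
  have "cfun X \<in> {{f \<in> cfun X. f ` K \<subseteq> U} | K U. compactin X K \<and> open U}"
    by (rule CollectI, rule exI[of _ "{}"], rule exI[of _ UNIV]) auto
  then show ?thesis
    unfolding C\<^sub>k_def topology_generated_by_topspace by auto
qed

lemma zero_fun_in_cfun: "zero_fun X \<in> cfun X"
proof -
  have "continuous_map X euclideanreal (zero_fun X)"
    by (rule continuous_map_eq[of _ _ "\<lambda>_. 0"]) (auto simp: zero_fun_def)
  then show ?thesis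
    by (simp add: cfun_def zero_fun_def)
qed

section \<open>The families \<open>\<Omega>\<close>, \<open>\<K>\<close>, \<open>\<D>\<close> and \<open>\<Omega>\<^sub>x\<close>\<close>

definition nontrivial_open_cover :: "'a topology \<Rightarrow> 'a set set \<Rightarrow> bool" where
  "nontrivial_open_cover X \<U> \<longleftrightarrow>
     (\<forall>U\<in>\<U>. openin X U) \<and> \<Union>\<U> = topspace X \<and> topspace X \<notin> \<U>"

definition omega_covers :: "'a topology \<Rightarrow> 'a set set set" where
  "omega_covers X = {\<U>. nontrivial_open_cover X \<U> \<and>
     (\<forall>F. finite F \<and> F \<subseteq> topspace X \<longrightarrow> (\<exists>U\<in>\<U>. F \<subseteq> U))}"

definition k_covers :: "'a topology \<Rightarrow> 'a set set set" where
  "k_covers X = {\<U>. nontrivial_open_cover X \<U> \<and>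
     (\<forall>K. compactin X K \<longrightarrow> (\<exists>U\<in>\<U>. K \<subseteq> U))}"

definition dense_sets :: "'b topology \<Rightarrow> 'b set set" where
  "dense_sets Y = {A. A \<subseteq> topspace Y \<and> Y closure_of A = topspace Y}"

definition Omega_at :: "'b topology \<Rightarrow> 'b \<Rightarrow> 'b set set" where
  "Omega_at Y x = {A. A \<subseteq> topspace Y \<and> x \<in> Y closure_of A - A}"

section \<open>Selection principles and games\<close>

definition S_fin :: "'b set set \<Rightarrow> 'b set set \<Rightarrow> bool" where
  "S_fin \<A> \<B> \<longleftrightarrow>
     (\<forall>A :: nat \<Rightarrow> 'b set. (\<forall>n. A n \<in> \<A>) \<longrightarrow>
        (\<exists>B :: nat \<Rightarrow> 'b set. (\<forall>n. finite (B n) \<and> B n \<subseteq> A n) \<and> (\<Union>n. B n) \<in> \<B>))"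

definition moves_TWO :: "'b set set \<Rightarrow> 'b set set" where
  "moves_TWO \<A> = {B. finite B \<and> (\<exists>A\<in>\<A>. B \<subseteq> A)}"

definition strategy_ONE :: "'b set set \<Rightarrow> ('b set list \<Rightarrow> 'b set) \<Rightarrow> bool" where
  "strategy_ONE \<A> \<sigma> \<longleftrightarrow> (\<forall>Bs \<in> lists (moves_TWO \<A>). \<sigma> Bs \<in> \<A>)"

text \<open>When ONE follows \<open>\<sigma>\<close>, the set played in round \<open>n\<close> is the value of \<open>\<sigma>\<close> at the list
  of TWO's moves in the rounds \<open>0, \<dots>, n - 1\<close>; a play is thus determined by TWO's moves.\<close>

definition winning_strategy_ONE ::
  "'b set set \<Rightarrow> 'b set set \<Rightarrow> ('b set list \<Rightarrow> 'b set) \<Rightarrow> bool" where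
  "winning_strategy_ONE \<A> \<B> \<sigma> \<longleftrightarrow>
     strategy_ONE \<A> \<sigma> \<and>
     (\<forall>B :: nat \<Rightarrow> 'b set.
        (\<forall>n. finite (B n) \<and> B n \<subseteq> \<sigma> (map B [0..<n])) \<longrightarrow> (\<Union>n. B n) \<notin> \<B>)"

definition ONE_has_winning_strategy_G_fin :: "'b set set \<Rightarrow> 'b set set \<Rightarrow> bool" where
  "ONE_has_winning_strategy_G_fin \<A> \<B> \<longleftrightarrow> (\<exists>\<sigma>. winning_strategy_ONE \<A> \<B> \<sigma>)"

definition all_equivalent :: "bool list \<Rightarrow> bool" where
  "all_equivalent Ps \<longleftrightarrow> (\<forall>P\<in>set Ps. \<forall>Q\<in>set Ps. P \<longleftrightarrow> Q)"

end

theory Submission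
  imports Defs
begin

text \<open>
  Everything is compared with one property of \<open>X\<close>, here called \<^emph>\<open>omega-Menger\<close>: the
  finite-selection principle for open families in which every finite set lies in some member. (It is
  equivalent to all finite powers of \<open>X\<close> being Menger spaces.)

  The implication that is not evident is that selection from k-covers already gives this property
  (\<open>S_fin_k_omega_imp_omega_menger\<close>). Fix \<open>q\<close> and let \<open>\<A>\<close> be an open omega-family. By compactness of
  the power \<open>K\<^sup>q\<close> every compact \<open>K\<close> has an open neighbourhood \<open>V\<close> all of whose subsets of size at most
  \<open>q\<close> are caught by one finite subfamily of \<open>\<A>\<close>. So the sets \<open>V\<close> with such a finite subfamily catch
  all compact sets; finitely many chosen \<open>V\<close> bring along finitely many members of \<open>\<A>\<close>. This step
  is essential for the games: selection cuts a k-cover down to a countable omega-cover, but not to a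
  countable k-cover, so it prunes ONE's game tree to a countable tree of omega-families only, and
  then a selection principle for omega-families is called for.

  The second ingredient is Hurewicz's argument that ONE cannot win the Menger game, in the form of
  \<open>TWO_beats_strategy\<close>: if ONE's moves consist of objects \<open>b\<close>, each carrying countably many open
  sets \<open>U q b\<close>, and if for every \<open>q\<close> these sets form an omega-family, then TWO has a play that
  catches every finite set for every \<open>q\<close>. The index \<open>q\<close> is what handles function spaces: for
  \<open>f \<in> C(X)\<close> the sets \<open>U q f\<close> are those where \<open>f\<close> is close to zero, with precision given by \<open>q\<close>, or
  close to the members of a fixed sequence that is dense for pointwise convergence. The countable
  i-weight provides that sequence (\<open>pointwise_dense_sequence\<close>).

  Hence the selection principle for k-covers refutes ONE's strategies in all four games. A sequence
  of moves is a strategy that ignores TWO, so each game statement gives back its selection principle;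
  and each of the three selection principles for function spaces gives that for k-covers, by applying
  it to the functions that equal \<open>1\<close> outside some member of the given cover
  (\<open>S_fin_k_omega_from_C\<^sub>k\<close>). These sets are dense in the compact-open topology and omit the zero
  function, so that they serve as moves for all three.
\<close>

section \<open>Open families catching all finite or all compact sets\<close>

text \<open>Unlike for a nontrivial cover, the whole space may be a member of the next two kinds of family,
  so that compact spaces need no separate treatment.\<close>

definition open_omega_family :: "'a topology \<Rightarrow> 'a set set \<Rightarrow> bool" where
  "open_omega_family X \<A> \<longleftrightarrow>
     (\<forall>U\<in>\<A>. openin X U) \<and> (\<forall>F. finite F \<and> F \<subseteq> topspace X \<longrightarrow> (\<exists>U\<in>\<A>. F \<subseteq> U))"

definition open_k_family :: "'a topology \<Rightarrow> 'a set set \<Rightarrow> bool" where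
  "open_k_family X \<A> \<longleftrightarrow>
     (\<forall>U\<in>\<A>. openin X U) \<and> (\<forall>K. compactin X K \<longrightarrow> (\<exists>U\<in>\<A>. K \<subseteq> U))"

definition omega_menger :: "'a topology \<Rightarrow> bool" where
  "omega_menger X \<longleftrightarrow>
     (\<forall>\<A> :: nat \<Rightarrow> 'a set set. (\<forall>n. open_omega_family X (\<A> n)) \<longrightarrow>
        (\<exists>\<B>. (\<forall>n. finite (\<B> n) \<and> \<B> n \<subseteq> \<A> n) \<and>
             (\<forall>F. finite F \<and> F \<subseteq> topspace X \<longrightarrow> (\<exists>n. \<exists>U\<in>\<B> n. F \<subseteq> U))))"

lemma open_omega_familyD:
  assumes "open_omega_family X \<A>" "finite F" "F \<subseteq> topspace X"
  obtains U where "U \<in> \<A>" "F \<subseteq> U"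
  using assms unfolding open_omega_family_def by blast

lemma omega_mengerE:
  fixes \<A> :: "nat \<Rightarrow> 'a set set"
  assumes "omega_menger X" "\<And>n. open_omega_family X (\<A> n)"
  obtains \<B> where "\<And>n. finite (\<B> n)" "\<And>n. \<B> n \<subseteq> \<A> n"
    "\<And>F. \<lbrakk>finite F; F \<subseteq> topspace X\<rbrakk> \<Longrightarrow> \<exists>n. \<exists>U\<in>\<B> n. F \<subseteq> U"
proof -
  obtain \<B> where "(\<forall>n. finite (\<B> n) \<and> \<B> n \<subseteq> \<A> n) \<and>
      (\<forall>F. finite F \<and> F \<subseteq> topspace X \<longrightarrow> (\<exists>n. \<exists>U\<in>\<B> n. F \<subseteq> U))"
    using assms(1)[unfolded omega_menger_def, rule_format, of \<A>, OF assms(2)] ..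
  then show ?thesis
    by (intro that[of \<B>]) simp_all
qed

lemma k_cover_is_open_omega_family: "\<A> \<in> k_covers X \<Longrightarrow> open_omega_family X \<A>"
  unfolding k_covers_def nontrivial_open_cover_def open_omega_family_def
  using finite_imp_compactin by blast

section \<open>From k-covers to omega-covers\<close>

text \<open>A sequence in which some family contains the whole space is trivial to select from; otherwise
  the families are k-covers.\<close>

lemma S_fin_k_families:
  fixes \<A> :: "nat \<Rightarrow> 'a set set"
  assumes S: "S_fin (k_covers X) (omega_covers X)" and A: "\<And>n. open_k_family X (\<A> n)"
  shows "\<exists>\<B>. (\<forall>n. finite (\<B> n) \<and> \<B> n \<subseteq> \<A> n) \<and>
      (\<forall>F. finite F \<and> F \<subseteq> topspace X \<longrightarrow> (\<exists>n. \<exists>U\<in>\<B> n. F \<subseteq> U))"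
proof (cases "\<exists>n. topspace X \<in> \<A> n")
  case True
  then obtain m where "topspace X \<in> \<A> m" ..
  then show ?thesis
    by (intro exI[of _ "\<lambda>n. if n = m then {topspace X} else {}"]) auto
next
  case False
  have "\<A> n \<in> k_covers X" for n
  proof -
    have "\<Union>(\<A> n) \<subseteq> topspace X"
      using A[of n] openin_subset unfolding open_k_family_def by blast
    moreover have "x \<in> \<Union>(\<A> n)" if "x \<in> topspace X" for x
      using A[of n] that unfolding open_k_family_def
      by (metis UnionI compactin_sing insert_subset)
    ultimately show ?thesis
      using A[of n] False unfolding k_covers_def nontrivial_open_cover_def open_k_family_def by blast
  qed
  then obtain \<B> where "\<forall>n. finite (\<B> n) \<and> \<B> n \<subseteq> \<A> n" "(\<Union>n. \<B> n) \<in> omega_covers X"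
    using S[unfolded S_fin_def, rule_format, of \<A>] by blast
  then show ?thesis
    unfolding omega_covers_def by (intro exI[of _ \<B>]) blast
qed

text \<open>This is compactness of the power \<open>K\<^sup>q\<close> together with the tube lemma, but by induction on \<open>q\<close>
  instead of in a product space: for a point \<open>x\<close> the members of \<open>\<A>\<close> containing \<open>x\<close> are again an
  omega-family, and a finite subfamily of them that catches all \<open>q\<close>-element subsets of a
  neighbourhood of \<open>K\<close> also catches these sets with one further point near \<open>x\<close> adjoined.\<close>

lemma compact_caught_by_finite_subfamily:
  assumes "compactin X K" and "open_omega_family X \<A>"
  shows "\<exists>V \<G>. openin X V \<and> K \<subseteq> V \<and> finite \<G> \<and> \<G> \<subseteq> \<A> \<and>
    (\<forall>F. finite F \<and> F \<subseteq> V \<and> card F \<le> q \<longrightarrow> (\<exists>U\<in>\<G>. F \<subseteq> U))"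
  using assms(2)
proof (induction q arbitrary: \<A>)
  case 0
  obtain U where "U \<in> \<A>"
    using open_omega_familyD[OF 0, of "{}"] by auto
  then show ?case
    using compactin_subset_topspace[OF assms(1)]
    by (intro exI[of _ "topspace X"] exI[of _ "{U}"]) auto
next
  case (Suc q)
  \<comment> \<open>\<open>U0\<close> catches the empty set, also when \<open>K\<close> is empty and no points are selected below.\<close>
  obtain U0 where U0: "U0 \<in> \<A>"
    using open_omega_familyD[OF Suc.prems, of "{}"] by auto
  have KX: "K \<subseteq> topspace X"
    using assms(1) compactin_subset_topspace by blast
  define caught where "caught x V \<G> \<longleftrightarrow> openin X V \<and> K \<subseteq> V \<and> finite \<G> \<and> \<G> \<subseteq> {U\<in>\<A>. x \<in> U} \<and>
      (\<forall>F. finite F \<and> F \<subseteq> V \<and> card F \<le> q \<longrightarrow> (\<exists>U\<in>\<G>. F \<subseteq> U))" for x V \<G>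
  have "\<exists>V \<G>. caught x V \<G>" if "x \<in> K" for x
    unfolding caught_def
  proof (rule Suc.IH)
    have "\<exists>U\<in>{U\<in>\<A>. x \<in> U}. F \<subseteq> U" if "finite F" "F \<subseteq> topspace X" for F
    proof -
      obtain U where "U \<in> \<A>" "insert x F \<subseteq> U"
        using open_omega_familyD[OF Suc.prems, of "insert x F"] \<open>finite F\<close> \<open>F \<subseteq> topspace X\<close> KX
          \<open>x \<in> K\<close> by blast
      then show ?thesis
        by blast
    qed
    then show "open_omega_family X {U\<in>\<A>. x \<in> U}"
      using Suc.prems unfolding open_omega_family_def by blast
  qed
  then obtain V \<G> where caught: "\<And>x. x \<in> K \<Longrightarrow> caught x (V x) (\<G> x)"
    by metis
  have V: "openin X (V x)" "K \<subseteq> V x" and G: "finite (\<G> x)" "\<G> x \<subseteq> {U\<in>\<A>. x \<in> U}"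
    and VG: "\<And>F. \<lbrakk>finite F; F \<subseteq> V x; card F \<le> q\<rbrakk> \<Longrightarrow> \<exists>U\<in>\<G> x. F \<subseteq> U" if "x \<in> K" for x
    using caught[OF that] by (simp_all add: caught_def)
  define W where "W x = topspace X \<inter> \<Inter>(\<G> x)" for x
  have Wopen: "openin X (W x)" if "x \<in> K" for x
  proof -
    have "\<forall>U\<in>\<G> x. openin X U"
      using G(2)[OF that] Suc.prems unfolding open_omega_family_def by blast
    then show ?thesis
      unfolding W_def using openin_Inter[of "insert (topspace X) (\<G> x)" X] G(1)[OF that] by auto
  qed
  have "x \<in> W x" if "x \<in> K" for x
    using that G(2) KX unfolding W_def by blast
  then have "K \<subseteq> \<Union>(W ` K)"
    by blast
  then obtain \<F> where "finite \<F>" "\<F> \<subseteq> W ` K" "K \<subseteq> \<Union>\<F>"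
    using assms(1) Wopen unfolding compactin_def by (metis (no_types, lifting) imageE)
  then obtain T where T: "finite T" "T \<subseteq> K" "K \<subseteq> \<Union>(W ` T)"
    by (metis finite_subset_image)
  define V' where "V' = \<Inter>(insert (\<Union>(W ` T)) (V ` T))"
  have "openin X (\<Union>(W ` T))"
    using Wopen T(2) by (intro openin_Union) blast
  then have "\<forall>U\<in>insert (\<Union>(W ` T)) (V ` T). openin X U"
    using V(1) T(2) by blast
  then have V'_open: "openin X V'"
    unfolding V'_def using T(1) by (intro openin_Inter) auto
  show ?case
  proof (intro exI conjI allI impI)
    show "openin X V'"
      by (fact V'_open)
    show "K \<subseteq> V'"
      unfolding V'_def using T V(2) by blast
    show "finite (insert U0 (\<Union>(\<G> ` T)))"
      using T G by auto
    show "insert U0 (\<Union>(\<G> ` T)) \<subseteq> \<A>"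
      using T(2) G(2) U0 by blast
    fix F assume F: "finite F \<and> F \<subseteq> V' \<and> card F \<le> Suc q"
    show "\<exists>U\<in>insert U0 (\<Union>(\<G> ` T)). F \<subseteq> U"
    proof (cases "F = {}")
      case False
      then obtain y where y: "y \<in> F"
        by blast
      then obtain x where x: "x \<in> T" "y \<in> W x"
        using F unfolding V'_def by auto
      have "card (F - {y}) \<le> q"
        using F y by (simp add: card_Diff_singleton le_diff_conv)
      moreover have "F - {y} \<subseteq> V x"
        using F x unfolding V'_def by auto
      ultimately obtain U where "U \<in> \<G> x" "F - {y} \<subseteq> U"
        using VG[of x "F - {y}"] x T F by blast
      then show ?thesis
        using x unfolding W_def by blast
    qed auto
  qed
qed

text \<open>A selection made for one size \<open>q\<close> only catches sets with at most \<open>q\<close> elements. So the given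
  sequence is split into infinitely many subsequences, one for each size.\<close>

theorem S_fin_k_omega_imp_omega_menger:
  assumes S: "S_fin (k_covers X) (omega_covers X)"
  shows "omega_menger X"
  unfolding omega_menger_def
proof (intro allI impI)
  fix \<A> :: "nat \<Rightarrow> 'a set set"
  assume A: "\<forall>n. open_omega_family X (\<A> n)"
  define good where "good q n V \<G> \<longleftrightarrow> finite \<G> \<and> \<G> \<subseteq> \<A> (prod_encode (q, n)) \<and>
    (\<forall>F. finite F \<and> F \<subseteq> V \<and> card F \<le> q \<longrightarrow> (\<exists>U\<in>\<G>. F \<subseteq> U))" for q n V \<G>
  have "\<exists>V\<in>{V. openin X V \<and> (\<exists>\<G>. good q n V \<G>)}. K \<subseteq> V" if K: "compactin X K" for q n K
  proof -
    obtain V \<G> where "openin X V" "K \<subseteq> V" "good q n V \<G>"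
      using compact_caught_by_finite_subfamily[OF K A[rule_format, of "prod_encode (q, n)"], of q]
      unfolding good_def by auto
    then show ?thesis
      by blast
  qed
  then have "open_k_family X {V. openin X V \<and> (\<exists>\<G>. good q n V \<G>)}" for q n
    by (simp add: open_k_family_def)
  then have "\<exists>\<B>. (\<forall>n. finite (\<B> n) \<and> \<B> n \<subseteq> {V. openin X V \<and> (\<exists>\<G>. good q n V \<G>)}) \<and>
      (\<forall>F. finite F \<and> F \<subseteq> topspace X \<longrightarrow> (\<exists>n. \<exists>V\<in>\<B> n. F \<subseteq> V))" for q
    by (intro S_fin_k_families[OF S])
  then obtain \<B> where B: "\<And>q. (\<forall>n. finite (\<B> q n) \<and> \<B> q n \<subseteq> {V. openin X V \<and> (\<exists>\<G>. good q n V \<G>)}) \<and>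
      (\<forall>F. finite F \<and> F \<subseteq> topspace X \<longrightarrow> (\<exists>n. \<exists>V\<in>\<B> q n. F \<subseteq> V))"
    by metis
  have finB: "finite (\<B> q n)" for q n
    using B by blast
  have "\<exists>\<G>. good q n V \<G>" if "V \<in> \<B> q n" for q n V
    using B[of q] that by blast
  then have g: "good q n V (SOME \<G>. good q n V \<G>)" if "V \<in> \<B> q n" for q n V
    using that by (blast intro: someI_ex)
  define g where "g q n V = (SOME \<G>. good q n V \<G>)" for q n V
  note g = g[folded g_def]
  define \<C> where "\<C> k = (case prod_decode k of (q, n) \<Rightarrow> \<Union>(g q n ` \<B> q n))" for k
  show "\<exists>\<C>. (\<forall>n. finite (\<C> n) \<and> \<C> n \<subseteq> \<A> n) \<and>
      (\<forall>F. finite F \<and> F \<subseteq> topspace X \<longrightarrow> (\<exists>n. \<exists>U\<in>\<C> n. F \<subseteq> U))"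
  proof (intro exI[of _ \<C>] conjI allI impI)
    fix k
    obtain q n where k: "prod_decode k = (q, n)" "k = prod_encode (q, n)"
      by (metis prod.exhaust prod_decode_inverse)
    have good: "finite (g q n V)" "g q n V \<subseteq> \<A> k" if "V \<in> \<B> q n" for V
      using g[OF that] by (simp_all add: good_def k(2))
    have C: "\<C> k = \<Union>(g q n ` \<B> q n)"
      by (simp add: \<C>_def k(1))
    show "finite (\<C> k)"
      unfolding C using good(1) finB by blast
    show "\<C> k \<subseteq> \<A> k"
      unfolding C using good(2) by blast
  next
    fix F assume F: "finite F \<and> F \<subseteq> topspace X"
    then obtain n V where "V \<in> \<B> (card F) n" "F \<subseteq> V"
      using B[of "card F", THEN conjunct2, rule_format, OF F] by auto
    moreover obtain U where "U \<in> g (card F) n V" "F \<subseteq> U"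
      using g[OF \<open>V \<in> \<B> (card F) n\<close>] F \<open>F \<subseteq> V\<close> by (auto simp: good_def)
    moreover have "\<C> (prod_encode (card F, n)) = \<Union>(g (card F) n ` \<B> (card F) n)"
      by (simp add: \<C>_def)
    ultimately have "\<exists>U\<in>\<C> (prod_encode (card F, n)). F \<subseteq> U"
      by blast
    then show "\<exists>k. \<exists>U\<in>\<C> k. F \<subseteq> U" ..
  qed
qed

section \<open>Games\<close>

text \<open>The analogue of the Lindelof property: a constant sequence of families yields a countable
  subfamily. It lets TWO restrict to countably many answers in each position.\<close>

lemma countable_catching_enumeration:
  fixes U :: "nat \<Rightarrow> 'b \<Rightarrow> 'a set"
  assumes menger: "omega_menger X" and A: "\<And>q. open_omega_family X (U q ` A)"
  shows "\<exists>e :: nat \<Rightarrow> 'b. (\<forall>i. e i \<in> A) \<and>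
    (\<forall>q F. finite F \<and> F \<subseteq> topspace X \<longrightarrow> (\<exists>i. F \<subseteq> U q (e i)))"
proof -
  have "\<exists>C. countable C \<and> C \<subseteq> A \<and> (\<forall>F. finite F \<and> F \<subseteq> topspace X \<longrightarrow> (\<exists>a\<in>C. F \<subseteq> U q a))" for q
  proof -
    obtain \<B> where B: "\<And>n :: nat. finite (\<B> n)" "\<And>n. \<B> n \<subseteq> U q ` A"
      and catch: "\<And>F. \<lbrakk>finite F; F \<subseteq> topspace X\<rbrakk> \<Longrightarrow> \<exists>n. \<exists>V\<in>\<B> n. F \<subseteq> V"
      using omega_mengerE[OF menger, of "\<lambda>_. U q ` A"] A by blast
    have "countable (\<Union>n. \<B> n)"
      using B(1) by (simp add: countable_finite)
    moreover have "(\<Union>n. \<B> n) \<subseteq> U q ` A"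
      using B(2) by blast
    ultimately obtain C where "countable C" "C \<subseteq> A" "(\<Union>n. \<B> n) = U q ` C"
      unfolding countable_subset_image by (metis countable_subset_image)
    moreover have "\<exists>a\<in>C. F \<subseteq> U q a" if F: "finite F \<and> F \<subseteq> topspace X" for F
    proof -
      obtain n V where "V \<in> \<B> n" "F \<subseteq> V"
        using catch F by blast
      moreover have "V \<in> U q ` C"
        using \<open>V \<in> \<B> n\<close> \<open>(\<Union>n. \<B> n) = U q ` C\<close> by blast
      ultimately show ?thesis
        by blast
    qed
    ultimately show ?thesis
      by blast
  qed
  then obtain C where C: "\<And>q. countable (C q) \<and> C q \<subseteq> A \<and>
      (\<forall>F. finite F \<and> F \<subseteq> topspace X \<longrightarrow> (\<exists>a\<in>C q. F \<subseteq> U q a))"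
    by metis
  have ne: "(\<Union>q. C q) \<noteq> {}"
    using C[of 0] by blast
  have ctbl: "countable (\<Union>q. C q)"
    using C by blast
  show ?thesis
  proof (intro exI[of _ "from_nat_into (\<Union>q. C q)"] conjI allI impI)
    fix i
    show "from_nat_into (\<Union>q. C q) i \<in> A"
      using from_nat_into[OF ne, of i] C by blast
  next
    fix q F
    assume "finite F \<and> F \<subseteq> topspace X"
    then obtain a where a: "a \<in> C q" "F \<subseteq> U q a"
      using C by blast
    then have "a \<in> range (from_nat_into (\<Union>q. C q))"
      using range_from_nat_into[OF ne ctbl] by blast
    then show "\<exists>i. F \<subseteq> U q (from_nat_into (\<Union>q. C q) i)"
      using a by blast
  qed
qed

text \<open>Hurewicz's argument. \<open>T q t i\<close> is the \<open>i\<close>-th open set for the index \<open>q\<close> in the position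
  reached after TWO played the numbers in \<open>t\<close> (latest first); playing \<open>k\<close> means taking the sets
  numbered up to \<open>k\<close>. Let \<open>h(n)\<close> be the least number that catches \<open>F\<close> in every position of
  length and entries at most \<open>n\<close>. TWO has to bound \<open>h\<close> somewhere along its own play. The
  condition \<open>h(h(n)) \<le> k\<close> passes from \<open>F\<close> to all subsets of an open neighbourhood of \<open>F\<close>, so the
  omega-Menger property gives a function \<open>g\<close>, the same for all \<open>F\<close>, with \<open>h(h(n)) \<le> g(n)\<close> for
  some \<open>n\<close> that depends on \<open>F\<close>. Let TWO play along the iterates of \<open>g\<close>, and
  let \<open>N\<close>, \<open>N'\<close>, \<open>N''\<close> be successive iterates with \<open>N \<le> n < N'\<close>. If \<open>h(n) \<le> N'\<close> then
  \<open>h(N) \<le> N'\<close>; otherwise \<open>h(N') \<le> h(h(n)) \<le> g(n) \<le> N''\<close>. In both cases some iterate bounds \<open>h\<close> at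
  its predecessor. Iterating \<open>h\<close> twice is what makes up for the gap between \<open>n\<close> and \<open>N\<close>.\<close>

lemma catching_branch:
  fixes T :: "nat \<Rightarrow> nat list \<Rightarrow> nat \<Rightarrow> 'a set"
  assumes menger: "omega_menger X"
    and openT: "\<And>q t i. openin X (T q t i)"
    and catch: "\<And>q t F. \<lbrakk>finite F; F \<subseteq> topspace X\<rbrakk> \<Longrightarrow> \<exists>i. F \<subseteq> T q t i"
  shows "\<exists>k :: nat \<Rightarrow> nat. \<forall>q F. finite F \<and> F \<subseteq> topspace X \<longrightarrow>
    (\<exists>j. \<exists>i\<le>k j. F \<subseteq> T q (rev (map k [0..<j])) i)"
proof -
  define L where "L n = {t. set t \<subseteq> {..n} \<and> length t \<le> n}" for n :: nat
  have finL: "finite (L n)" for n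
    unfolding L_def by (rule finite_lists_length_le) simp
  have neL: "L n \<noteq> {}" for n
    unfolding L_def by (auto intro: exI[of _ "[]"])
  have monoL: "L n \<subseteq> L m" if "n \<le> m" for n m
    using that unfolding L_def by force
  \<comment> \<open>\<open>cov q F n k\<close> says \<open>h(n) \<le> k\<close>, and \<open>cov2 q F n k\<close> below says \<open>h(h(n)) \<le> k\<close>.\<close>
  define cov where "cov q F n k \<longleftrightarrow> (\<forall>t\<in>L n. \<exists>i\<le>k. F \<subseteq> T q t i)" for q F n k
  have cov_mono: "cov q F n' k'" if "cov q F n k" "n' \<le> n" "k \<le> k'" for q F n n' k k'
    using that monoL[of n' n] unfolding cov_def by (meson le_trans subsetD)
  have cov_ex: "\<exists>k. cov q F n k" if F: "finite F" "F \<subseteq> topspace X" for q F n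
  proof -
    obtain i where i: "\<And>t. F \<subseteq> T q t (i t)"
      using catch[OF F] by metis
    obtain k where "\<forall>x\<in>i ` L n. x \<le> k"
      using finL[of n] finite_nat_set_iff_bounded_le[of "i ` L n"] by auto
    then show ?thesis
      unfolding cov_def using i by blast
  qed
  have cov_open: "\<exists>V. openin X V \<and> F \<subseteq> V \<and> (\<forall>F'\<subseteq>V. cov q F' n k)" if cov: "cov q F n k" for q F n k
  proof -
    obtain i where i: "\<forall>t\<in>L n. i t \<le> k \<and> F \<subseteq> T q t (i t)"
      using cov unfolding cov_def by metis
    have "openin X (\<Inter>t\<in>L n. T q t (i t))"
      using finL[of n] neL[of n] openT by (intro openin_Inter) auto
    moreover have "F \<subseteq> (\<Inter>t\<in>L n. T q t (i t))"
      using i by blast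
    moreover have "cov q F' n k" if "F' \<subseteq> (\<Inter>t\<in>L n. T q t (i t))" for F'
      unfolding cov_def using that i by blast
    ultimately show ?thesis
      by blast
  qed
  define cov2 where "cov2 q F n k \<longleftrightarrow> (\<exists>m. cov q F n m \<and> cov q F m k)" for q F n k
  \<comment> \<open>Shifting the sequence by \<open>q\<close> gives \<open>n \<ge> q\<close>, so that a single \<open>g\<close>, which dominates \<open>G q\<close>
    from \<open>q\<close> on, works for all \<open>q\<close>.\<close>
  have "\<exists>G. \<forall>F. finite F \<and> F \<subseteq> topspace X \<longrightarrow> (\<exists>n\<ge>q. cov2 q F n (G n))" for q
  proof -
    define \<W> where "\<W> n = {V. openin X V \<and> (\<exists>k. \<forall>F\<subseteq>V. cov2 q F (n + q) k)}" for n
    have "\<exists>V\<in>\<W> n. F \<subseteq> V" if F: "finite F" "F \<subseteq> topspace X" for n F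
    proof -
      obtain m k where m: "cov q F (n + q) m" and k: "cov q F m k"
        using cov_ex[OF F] by metis
      obtain V where V: "openin X V" "F \<subseteq> V" "\<forall>F'\<subseteq>V. cov q F' (n + q) m"
        using cov_open[OF m] by blast
      obtain V' where V': "openin X V'" "F \<subseteq> V'" "\<forall>F'\<subseteq>V'. cov q F' m k"
        using cov_open[OF k] by blast
      have "\<forall>F'\<subseteq>V \<inter> V'. cov2 q F' (n + q) k"
        unfolding cov2_def using V(3) V'(3) by blast
      then have "V \<inter> V' \<in> \<W> n"
        unfolding \<W>_def using V(1) V'(1) by blast
      then show ?thesis
        using V(2) V'(2) by blast
    qed
    then have fam: "open_omega_family X (\<W> n)" for n
      unfolding open_omega_family_def \<W>_def by blast
    obtain \<B> where B: "\<And>n. finite (\<B> n)" "\<And>n. \<B> n \<subseteq> \<W> n"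
      and BF: "\<And>F. \<lbrakk>finite F; F \<subseteq> topspace X\<rbrakk> \<Longrightarrow> \<exists>n. \<exists>V\<in>\<B> n. F \<subseteq> V"
      using omega_mengerE[OF menger, of \<W>, OF fam] by blast
    have "\<exists>K. \<forall>V\<in>\<B> n. \<forall>F\<subseteq>V. cov2 q F (n + q) K" for n
    proof -
      have "\<forall>V\<in>\<B> n. \<exists>k. \<forall>F\<subseteq>V. cov2 q F (n + q) k"
        using B(2)[of n] unfolding \<W>_def by blast
      then obtain k where k: "\<forall>V\<in>\<B> n. \<forall>F\<subseteq>V. cov2 q F (n + q) (k V)"
        by metis
      obtain K where K: "\<forall>x\<in>k ` \<B> n. x \<le> K"
        using B(1)[of n] finite_nat_set_iff_bounded_le[of "k ` \<B> n"] by auto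
      have "cov2 q F (n + q) K" if "V \<in> \<B> n" "F \<subseteq> V" for V F
        using k K that cov_mono unfolding cov2_def by (meson image_eqI order_refl)
      then show ?thesis
        by blast
    qed
    then obtain K where K: "\<And>n. \<forall>V\<in>\<B> n. \<forall>F\<subseteq>V. cov2 q F (n + q) (K n)"
      by metis
    show ?thesis
    proof (intro exI[of _ "\<lambda>n. K (n - q)"] allI impI)
      fix F
      assume F: "finite F \<and> F \<subseteq> topspace X"
      then obtain n V where "V \<in> \<B> n" "F \<subseteq> V"
        using BF by blast
      then have "cov2 q F (n + q) (K (n + q - q))"
        using K by simp
      then show "\<exists>n\<ge>q. cov2 q F n (K (n - q))"
        using le_add2 by blast
    qed
  qed
  then obtain G where G: "\<And>q. \<forall>F. finite F \<and> F \<subseteq> topspace X \<longrightarrow> (\<exists>n\<ge>q. cov2 q F n (G q n))"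
    by metis
  define g where "g n = Suc n + (\<Sum>q\<le>n. \<Sum>i\<le>n. G q i)" for n
  have g_gt: "n < g n" for n
    unfolding g_def by simp
  have g_mono: "g n \<le> g m" if "n \<le> m" for n m
  proof -
    have "(\<Sum>q\<le>n. \<Sum>i\<le>n. G q i) \<le> (\<Sum>q\<le>n. \<Sum>i\<le>m. G q i)"
      using that by (intro sum_mono sum_mono2) auto
    also have "\<dots> \<le> (\<Sum>q\<le>m. \<Sum>i\<le>m. G q i)"
      using that by (intro sum_mono2) auto
    finally show ?thesis
      unfolding g_def using that by simp
  qed
  have G_le: "G q n \<le> g n" if "q \<le> n" for q n
  proof -
    have "G q n \<le> (\<Sum>i\<le>n. G q i)"
      by (rule member_le_sum) auto
    also have "\<dots> \<le> (\<Sum>q\<le>n. \<Sum>i\<le>n. G q i)"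
      using that by (intro member_le_sum[of q "{..n}" "\<lambda>q. \<Sum>i\<le>n. G q i"]) auto
    finally show ?thesis
      unfolding g_def by simp
  qed
  define N where "N j = (g ^^ j) 0" for j
  have N_Suc: "N (Suc j) = g (N j)" for j
    unfolding N_def by simp
  have N_strict: "strict_mono N"
    using g_gt by (simp add: strict_mono_Suc_iff N_Suc)
  have history: "rev (map (\<lambda>j. N (Suc j)) [0..<j]) \<in> L (N j)" for j
  proof -
    have "N (Suc i) \<le> N j" if "i < j" for i
      using that strict_mono_less_eq[OF N_strict] by (simp add: Suc_le_eq)
    moreover have "j \<le> N j"
      using N_strict by (rule strict_mono_imp_increasing)
    ultimately show ?thesis
      unfolding L_def by auto
  qed
  show ?thesis
  proof (intro exI[of _ "\<lambda>j. N (Suc j)"] allI impI)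
    fix q F
    assume F: "finite F \<and> F \<subseteq> topspace X"
    then obtain n where n: "q \<le> n" "cov2 q F n (G q n)"
      using G by blast
    then obtain m where m: "cov q F n m" "cov q F m (G q n)"
      unfolding cov2_def by blast
    obtain j where j: "N j \<le> n" "n < N (Suc j)"
    proof -
      have "\<exists>i. n < N i"
        using strict_mono_imp_increasing[OF N_strict, of "Suc n"] by (metis Suc_le_eq)
      then obtain i where i: "n < N i" "\<forall>l<i. \<not> n < N l"
        using exists_least_iff[of "\<lambda>i. n < N i"] by blast
      moreover have "i \<noteq> 0"
        using i(1) by (auto simp: N_def intro: ccontr)
      ultimately show thesis
        using that[of "i - 1"] by (metis One_nat_def Suc_pred diff_less lessI neq0_conv not_le)
    qed
    have "G q n \<le> N (Suc (Suc j))"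
      using G_le[OF n(1)] g_mono[of n "N (Suc j)"] j(2) by (simp add: N_Suc)
    then have "\<exists>j. cov q F (N j) (N (Suc j))"
    proof (cases "m \<le> N (Suc j)")
      case True
      then show ?thesis
        using cov_mono[OF m(1) j(1)] by blast
    next
      case False
      then show ?thesis
        using cov_mono[OF m(2), of "N (Suc j)"] \<open>G q n \<le> N (Suc (Suc j))\<close> by (meson nat_le_linear)
    qed
    then show "\<exists>j. \<exists>i\<le>N (Suc j). F \<subseteq> T q (rev (map (\<lambda>j. N (Suc j)) [0..<j])) i"
      using history unfolding cov_def by blast
  qed
qed

text \<open>The set \<open>M\<close> of TWO's possible moves is a parameter because \<open>\<sigma>\<close> may be a restriction of ONE's
  original strategy, for instance with the zero function removed, while legality still refers to the
  original game.\<close>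

lemma TWO_catches_finite_sets:
  fixes U :: "nat \<Rightarrow> 'b \<Rightarrow> 'a set" and \<sigma> :: "'b set list \<Rightarrow> 'b set"
  assumes menger: "omega_menger X"
    and M: "\<And>s B. \<lbrakk>s \<in> lists M; finite B; B \<subseteq> \<sigma> s\<rbrakk> \<Longrightarrow> B \<in> M"
    and fam: "\<And>s q. s \<in> lists M \<Longrightarrow> open_omega_family X (U q ` \<sigma> s)"
  shows "\<exists>B. (\<forall>n. finite (B n) \<and> B n \<subseteq> \<sigma> (map B [0..<n])) \<and>
    (\<forall>q F. finite F \<and> F \<subseteq> topspace X \<longrightarrow> (\<exists>n. \<exists>b\<in>B n. F \<subseteq> U q b))"
proof -
  have "\<exists>e. (\<forall>i. e i \<in> \<sigma> s) \<and>
      (\<forall>q F. finite F \<and> F \<subseteq> topspace X \<longrightarrow> (\<exists>i :: nat. F \<subseteq> U q (e i)))" if "s \<in> lists M" for s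
    using countable_catching_enumeration[OF menger fam[OF that]] .
  then obtain e where e: "\<And>s. s \<in> lists M \<Longrightarrow> (\<forall>i. e s i \<in> \<sigma> s) \<and>
      (\<forall>q F. finite F \<and> F \<subseteq> topspace X \<longrightarrow> (\<exists>i :: nat. F \<subseteq> U q (e s i)))"
    by metis
  define pos where "pos = rec_list [] (\<lambda>k _ s. s @ [e s ` {..k}])"
  have pos_simps: "pos [] = []" "pos (k # t) = pos t @ [e (pos t) ` {..k}]" for k t
    unfolding pos_def by simp_all
  have pos: "pos t \<in> lists M" for t
  proof (induction t)
    case (Cons k t)
    have "e (pos t) ` {..k} \<in> M"
      using e[OF Cons.IH] by (intro M[OF Cons.IH]) auto
    then show ?case
      using Cons.IH by (simp add: pos_simps)
  qed (simp add: pos_simps)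
  have openT: "openin X (U q (e (pos t) i))" for q t i
    using fam[OF pos, of q t] e[OF pos, of t] unfolding open_omega_family_def by blast
  have catch: "\<exists>i. F \<subseteq> U q (e (pos t) i)" if "finite F" "F \<subseteq> topspace X" for q t F
    using e[OF pos, of t] that by blast
  obtain k :: "nat \<Rightarrow> nat" where k: "\<forall>q F. finite F \<and> F \<subseteq> topspace X \<longrightarrow>
      (\<exists>j. \<exists>i\<le>k j. F \<subseteq> U q (e (pos (rev (map k [0..<j]))) i))"
    using catching_branch[OF menger, of "\<lambda>q t i. U q (e (pos t) i)", OF openT catch] ..
  define B where "B j = e (pos (rev (map k [0..<j]))) ` {..k j}" for j
  have B: "map B [0..<j] = pos (rev (map k [0..<j]))" for j
    by (induction j) (simp_all add: pos_simps B_def)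
  show ?thesis
  proof (intro exI[of _ B] conjI allI impI)
    fix n
    show "finite (B n)"
      by (simp add: B_def)
    show "B n \<subseteq> \<sigma> (map B [0..<n])"
      unfolding B using e[OF pos] by (auto simp: B_def)
  next
    fix q F
    assume "finite F \<and> F \<subseteq> topspace X"
    then obtain j i where "i \<le> k j" "F \<subseteq> U q (e (pos (rev (map k [0..<j]))) i)"
      using k by blast
    then show "\<exists>n. \<exists>b\<in>B n. F \<subseteq> U q b"
      by (intro exI[of _ j]) (auto simp: B_def)
  qed
qed

text \<open>TWO may in addition commit to a part \<open>R A\<close> of each set \<open>A\<close> that ONE plays. This is how TWO
  avoids the zero function in a game where the final set must omit it.\<close>

lemma TWO_beats_strategy:
  fixes U :: "nat \<Rightarrow> 'b \<Rightarrow> 'a set" and R :: "'b set \<Rightarrow> 'b set"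
  assumes menger: "omega_menger X" and strategy: "strategy_ONE \<A> \<sigma>"
    and R: "\<And>A. A \<in> \<A> \<Longrightarrow> R A \<subseteq> A"
    and fam: "\<And>A q. A \<in> \<A> \<Longrightarrow> open_omega_family X (U q ` R A)"
  shows "\<exists>B. (\<forall>n. finite (B n) \<and> B n \<subseteq> R (\<sigma> (map B [0..<n])) \<and> \<sigma> (map B [0..<n]) \<in> \<A>) \<and>
    (\<forall>q F. finite F \<and> F \<subseteq> topspace X \<longrightarrow> (\<exists>n. \<exists>b\<in>B n. F \<subseteq> U q b))"
proof -
  have \<sigma>: "\<sigma> s \<in> \<A>" if "s \<in> lists (moves_TWO \<A>)" for s
    using strategy that unfolding strategy_ONE_def by blast
  have move: "B \<in> moves_TWO \<A>" if "s \<in> lists (moves_TWO \<A>)" "finite B" "B \<subseteq> R (\<sigma> s)" for s B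
    using R[OF \<sigma>[OF that(1)]] \<sigma>[OF that(1)] that(2,3) unfolding moves_TWO_def by blast
  have famR: "open_omega_family X (U q ` R (\<sigma> s))" if "s \<in> lists (moves_TWO \<A>)" for q s
    using fam[OF \<sigma>[OF that]] .
  obtain B where BB: "(\<forall>n. finite (B n) \<and> B n \<subseteq> R (\<sigma> (map B [0..<n]))) \<and>
      (\<forall>q F. finite F \<and> F \<subseteq> topspace X \<longrightarrow> (\<exists>n. \<exists>b\<in>B n. F \<subseteq> U q b))"
    using TWO_catches_finite_sets[OF menger, of "moves_TWO \<A>" "\<lambda>s. R (\<sigma> s)" U, OF move famR] ..
  have B: "finite (B n)" "B n \<subseteq> R (\<sigma> (map B [0..<n]))" for n
    using BB by blast+
  have position: "map B [0..<n] \<in> lists (moves_TWO \<A>)" for n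
  proof (induction n)
    case (Suc n)
    then show ?case
      using move[OF Suc B] by simp
  qed simp
  show ?thesis
    using BB \<sigma>[OF position] by (intro exI[of _ B]) simp
qed

lemma ONE_has_no_winning_strategyI:
  assumes "\<And>\<sigma>. strategy_ONE \<A> \<sigma> \<Longrightarrow>
    \<exists>B. (\<forall>n. finite (B n) \<and> B n \<subseteq> \<sigma> (map B [0..<n])) \<and> (\<Union>n. B n) \<in> \<B>"
  shows "\<not> ONE_has_winning_strategy_G_fin \<A> \<B>"
  using assms unfolding ONE_has_winning_strategy_G_fin_def winning_strategy_ONE_def by blast

lemma S_fin_if_ONE_has_no_winning_strategy:
  assumes "\<not> ONE_has_winning_strategy_G_fin \<A> \<B>"
  shows "S_fin \<A> \<B>"
  unfolding S_fin_def
proof (intro allI impI)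
  fix A :: "nat \<Rightarrow> 'a set"
  assume "\<forall>n. A n \<in> \<A>"
  then have "strategy_ONE \<A> (\<lambda>Bs. A (length Bs))"
    unfolding strategy_ONE_def by blast
  with assms obtain B where "\<forall>n. finite (B n) \<and> B n \<subseteq> A (length (map B [0..<n]))" "(\<Union>n. B n) \<in> \<B>"
    unfolding ONE_has_winning_strategy_G_fin_def winning_strategy_ONE_def by blast
  then show "\<exists>B. (\<forall>n. finite (B n) \<and> B n \<subseteq> A n) \<and> (\<Union>n. B n) \<in> \<B>"
    by auto
qed

section \<open>Topologies on spaces of continuous functions\<close>

lemma restrict_in_cfun:
  "continuous_map X euclideanreal f \<Longrightarrow> restrict f (topspace X) \<in> cfun X"
  unfolding cfun_def by (auto intro: continuous_map_eq)

lemma openin_close_points: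
  assumes "f \<in> cfun X" "g \<in> cfun X"
  shows "openin X {x \<in> topspace X. \<bar>f x - g x\<bar> < e}"
proof -
  have "continuous_map X euclideanreal (\<lambda>x. f x - g x)"
    using assms by (intro continuous_map_diff) (auto simp: cfun_def)
  then have "openin X {x \<in> topspace X. f x - g x \<in> ball 0 e}"
    by (rule openin_continuous_map_preimage) simp
  then show ?thesis
    by simp
qed

lemma evaluation_continuous_C\<^sub>k:
  "x \<in> topspace X \<Longrightarrow> continuous_map (C\<^sub>k X) euclideanreal (\<lambda>f. f x)"
proof -
  assume x: "x \<in> topspace X"
  have "openin (C\<^sub>k X) {f \<in> cfun X. f x \<in> U}" if "open U" for U
    unfolding C\<^sub>k_def using that x
    by (intro topology_generated_by_Basis CollectI exI[of _ "{x}"] exI[of _ U]) auto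
  then show ?thesis
    by (simp add: continuous_map_def topspace_C\<^sub>k)
qed

lemma evaluation_continuous_C\<^sub>p:
  "x \<in> topspace X \<Longrightarrow> continuous_map (C\<^sub>p X) euclideanreal (\<lambda>f. f x)"
  unfolding C\<^sub>p_def by (intro continuous_map_from_subtopology continuous_map_product_projection)

text \<open>Stated for any topology on \<open>C(X)\<close> with continuous evaluations, so that it applies to both
  topologies.\<close>

lemma closure_approximation:
  assumes T: "topspace T = cfun X" "\<And>x. x \<in> topspace X \<Longrightarrow> continuous_map T euclideanreal (\<lambda>f. f x)"
    and g: "g \<in> T closure_of A" and F: "finite F" "F \<subseteq> topspace X" and e: "e > (0 :: real)"
  shows "\<exists>f\<in>A. \<forall>x\<in>F. \<bar>f x - g x\<bar> < e"
proof -
  define N where "N x = {f \<in> topspace T. f x \<in> ball (g x) e}" for x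
  have "openin T (N x)" if "x \<in> F" for x
    unfolding N_def using T(2)[of x] F(2) that by (intro openin_continuous_map_preimage) auto
  then have "openin T (\<Inter>(insert (topspace T) (N ` F)))"
    using F(1) by (intro openin_Inter) auto
  moreover have "g \<in> \<Inter>(insert (topspace T) (N ` F))"
    using g e by (auto simp: N_def in_closure_of)
  ultimately obtain f where "f \<in> A" "f \<in> \<Inter>(insert (topspace T) (N ` F))"
    using g unfolding in_closure_of by blast
  then show ?thesis
    by (intro bexI[of _ f]) (auto simp: N_def dist_real_def abs_minus_commute)
qed

lemmas C\<^sub>k_closure_approximation = closure_approximation[OF topspace_C\<^sub>k evaluation_continuous_C\<^sub>k]
lemmas C\<^sub>p_closure_approximation = closure_approximation[OF topspace_C\<^sub>p evaluation_continuous_C\<^sub>p]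

lemma in_C\<^sub>p_closureI:
  assumes g: "g \<in> cfun X" and A: "A \<subseteq> cfun X"
    and approx: "\<And>F e. \<lbrakk>finite F; F \<subseteq> topspace X; e > (0 :: real)\<rbrakk> \<Longrightarrow> \<exists>f\<in>A. \<forall>x\<in>F. \<bar>f x - g x\<bar> < e"
  shows "g \<in> C\<^sub>p X closure_of A"
  unfolding in_closure_of
proof (intro conjI allI impI)
  show "g \<in> topspace (C\<^sub>p X)"
    using g by (simp add: topspace_C\<^sub>p)
  fix W
  assume W: "g \<in> W \<and> openin (C\<^sub>p X) W"
  then obtain W' where W': "openin (powertop_real (topspace X)) W'" "W = W' \<inter> cfun X"
    unfolding C\<^sub>p_def openin_subtopology by blast
  then have "g \<in> W'"
    using W by blast
  obtain P where P: "g \<in> (\<Pi>\<^sub>E x\<in>topspace X. P x)" "\<And>x. open (P x)"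
      "finite {x. P x \<noteq> UNIV}" "(\<Pi>\<^sub>E x\<in>topspace X. P x) \<subseteq> W'"
    using product_topology_open_contains_basis[OF W'(1) \<open>g \<in> W'\<close>] by auto
  define F where "F = {x. P x \<noteq> UNIV} \<inter> topspace X"
  have F: "finite F" "F \<subseteq> topspace X"
    using P(3) by (auto simp: F_def)
  have "\<forall>x\<in>F. \<exists>e>0. ball (g x) e \<subseteq> P x"
    using P(1,2) F(2) by (meson PiE_mem open_contains_ball subsetD)
  then obtain r where r: "\<And>x. x \<in> F \<Longrightarrow> r x > 0 \<and> ball (g x) (r x) \<subseteq> P x"
    by metis
  define e where "e = Min (insert 1 (r ` F))"
  have "e > 0"
    using F(1) r by (simp add: e_def)
  have e_le: "e \<le> r x" if "x \<in> F" for x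
    using F(1) that by (simp add: e_def)
  obtain f where f: "f \<in> A" "\<forall>x\<in>F. \<bar>f x - g x\<bar> < e"
    using approx[OF F \<open>e > 0\<close>] by blast
  have "f x \<in> P x" if x: "x \<in> topspace X" for x
  proof (cases "x \<in> F")
    case True
    then have "f x \<in> ball (g x) (r x)"
      using f(2) e_le[OF True] by (auto simp: dist_real_def abs_minus_commute intro: less_le_trans)
    then show ?thesis
      using r[OF True] by blast
  next
    case False
    then show ?thesis
      using x by (auto simp: F_def)
  qed
  moreover have "f \<in> cfun X"
    using f(1) A by blast
  ultimately have "f \<in> (\<Pi>\<^sub>E x\<in>topspace X. P x)"
    by (auto simp: cfun_def PiE_def)
  then have "f \<in> W"
    using P(4) W'(2) \<open>f \<in> cfun X\<close> by blast
  then show "\<exists>y. y \<in> A \<and> y \<in> W"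
    using f(1) by blast
qed

lemma C\<^sub>k_neighbourhood:
  assumes "openin (C\<^sub>k X) W" "g \<in> W"
  shows "\<exists>K. compactin X K \<and> (\<forall>f\<in>cfun X. (\<forall>x\<in>K. f x = g x) \<longrightarrow> f \<in> W)"
proof -
  have "generate_topology_on {{f \<in> cfun X. f ` K \<subseteq> U} | K U. compactin X K \<and> open U} W"
    using assms(1) unfolding C\<^sub>k_def openin_topology_generated_by_iff .
  then show ?thesis
    using assms(2)
  proof (induction W)
    case (Int W W')
    then obtain K K' where "compactin X K" "\<forall>f\<in>cfun X. (\<forall>x\<in>K. f x = g x) \<longrightarrow> f \<in> W"
      "compactin X K'" "\<forall>f\<in>cfun X. (\<forall>x\<in>K'. f x = g x) \<longrightarrow> f \<in> W'"
      by auto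
    then show ?case
      by (intro exI[of _ "K \<union> K'"]) (auto intro: compactin_Un)
  next
    case (UN \<W>)
    then obtain W where "W \<in> \<W>" "g \<in> W"
      by blast
    then show ?case
      using UN.IH[of W] by blast
  next
    case (Basis W)
    then obtain K U where "W = {f \<in> cfun X. f ` K \<subseteq> U}" "compactin X K"
      by blast
    then show ?case
      using Basis by (intro exI[of _ K]) auto
  qed simp
qed

lemma dense_in_C\<^sub>kI:
  assumes "D \<subseteq> cfun X"
    and "\<And>g K. \<lbrakk>g \<in> cfun X; compactin X K\<rbrakk> \<Longrightarrow> \<exists>f\<in>D. \<forall>x\<in>K. f x = g x"
  shows "D \<in> dense_sets (C\<^sub>k X)"
proof -
  have "g \<in> C\<^sub>k X closure_of D" if g: "g \<in> cfun X" for g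
    unfolding in_closure_of
  proof (intro conjI allI impI)
    fix W
    assume "g \<in> W \<and> openin (C\<^sub>k X) W"
    then obtain K where K: "compactin X K" "\<forall>f\<in>cfun X. (\<forall>x\<in>K. f x = g x) \<longrightarrow> f \<in> W"
      using C\<^sub>k_neighbourhood by blast
    then show "\<exists>y. y \<in> D \<and> y \<in> W"
      using assms(2)[OF g K(1)] assms(1) by blast
  qed (simp add: g topspace_C\<^sub>k)
  then show ?thesis
    using assms(1) closure_of_subset_topspace[of "C\<^sub>k X" D]
    unfolding dense_sets_def topspace_C\<^sub>k by blast
qed

lemma approximating_family:
  assumes "A \<subseteq> cfun X" "g \<in> cfun X"
    and "\<And>F. \<lbrakk>finite F; F \<subseteq> topspace X\<rbrakk> \<Longrightarrow> \<exists>f\<in>A. \<forall>x\<in>F. \<bar>f x - g x\<bar> < e"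
  shows "open_omega_family X ((\<lambda>f. {x \<in> topspace X. \<bar>f x - g x\<bar> < e}) ` A)"
  unfolding open_omega_family_def
proof (intro conjI allI impI)
  show "\<forall>U\<in>(\<lambda>f. {x \<in> topspace X. \<bar>f x - g x\<bar> < e}) ` A. openin X U"
    using assms(1,2) openin_close_points[of _ X g e] by auto
  fix F
  assume F: "finite F \<and> F \<subseteq> topspace X"
  then obtain f where f: "f \<in> A" "\<forall>x\<in>F. \<bar>f x - g x\<bar> < e"
    using assms(3) by blast
  then have "F \<subseteq> {x \<in> topspace X. \<bar>f x - g x\<bar> < e}"
    using F by blast
  then show "\<exists>U\<in>(\<lambda>f. {x \<in> topspace X. \<bar>f x - g x\<bar> < e}) ` A. F \<subseteq> U"
    using f(1) by blast
qed

section \<open>From function spaces to covers\<close>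

text \<open>For a k-cover \<open>\<A>\<close>, the functions that equal \<open>1\<close> off some member of \<open>\<A>\<close> are dense in \<open>C\<^sub>k(X)\<close>:
  on a compact set \<open>K \<subseteq> U \<in> \<A>\<close> any \<open>g\<close> can be kept while it is deformed to \<open>1\<close> outside \<open>U\<close>. If
  such a function has absolute value below \<open>1\<close> on \<open>F\<close>, then \<open>F\<close> lies in the associated member.\<close>

lemma S_fin_k_omega_from_C\<^sub>k:
  assumes reg: "completely_regular_space X"
    and sel: "\<And>D. (\<And>n :: nat. D n \<in> dense_sets (C\<^sub>k X)) \<Longrightarrow> (\<And>n. zero_fun X \<notin> D n) \<Longrightarrow>
      \<exists>B. (\<forall>n. finite (B n) \<and> B n \<subseteq> D n) \<and> zero_fun X \<in> C\<^sub>p X closure_of (\<Union>n. B n)"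
  shows "S_fin (k_covers X) (omega_covers X)"
  unfolding S_fin_def
proof (intro allI impI)
  fix \<A> :: "nat \<Rightarrow> 'a set set"
  assume A: "\<forall>n. \<A> n \<in> k_covers X"
  have A_open: "openin X U" and A_ne: "U \<noteq> topspace X" if "U \<in> \<A> n" for U n
    using A that unfolding k_covers_def nontrivial_open_cover_def by blast+
  define D where "D n = {f \<in> cfun X. \<exists>U\<in>\<A> n. \<forall>x\<in>topspace X - U. f x = 1}" for n
  have "D n \<in> dense_sets (C\<^sub>k X)" for n
  proof (rule dense_in_C\<^sub>kI)
    show "D n \<subseteq> cfun X"
      by (auto simp: D_def)
    fix g K
    assume g: "g \<in> cfun X" and K: "compactin X K"
    have "\<exists>U\<in>\<A> n. K \<subseteq> U"
      using A K unfolding k_covers_def by blast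
    then obtain U where U: "U \<in> \<A> n" "K \<subseteq> U"
      by blast
    have "closedin X (topspace X - U)" "disjnt K (topspace X - U)"
      using A_open[OF U(1)] U(2) by (auto simp: disjnt_def)
    then obtain \<phi> where \<phi>: "continuous_map X euclideanreal \<phi>" "\<phi> ` (topspace X - U) \<subseteq> {1}" "\<phi> ` K \<subseteq> {0}"
      using Urysohn_completely_regular_compact_closed_alt[OF reg K] by metis
    define f where "f = restrict (\<lambda>x. \<phi> x + (1 - \<phi> x) * g x) (topspace X)"
    have "continuous_map X euclideanreal (\<lambda>x. \<phi> x + (1 - \<phi> x) * g x)"
      using g \<phi>(1) by (intro continuous_intros) (auto simp: cfun_def)
    then have "f \<in> cfun X"
      unfolding f_def by (rule restrict_in_cfun)
    moreover have "\<forall>x\<in>topspace X - U. f x = 1"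
      using \<phi>(2) by (auto simp: f_def image_subset_iff)
    ultimately have "f \<in> D n"
      unfolding D_def using U(1) by blast
    moreover have "\<forall>x\<in>K. f x = g x"
      using \<phi>(3) compactin_subset_topspace[OF K] by (auto simp: f_def image_subset_iff)
    ultimately show "\<exists>f\<in>D n. \<forall>x\<in>K. f x = g x"
      by blast
  qed
  moreover have "zero_fun X \<notin> D n" for n
  proof
    assume "zero_fun X \<in> D n"
    then obtain U where U: "U \<in> \<A> n" "\<forall>x\<in>topspace X - U. zero_fun X x = 1"
      unfolding D_def by blast
    then obtain x where "x \<in> topspace X - U"
      using A_ne[OF U(1)] openin_subset[OF A_open[OF U(1)]] by blast
    then show False
      using U(2) by (auto simp: zero_fun_def)
  qed
  ultimately obtain B where B: "\<forall>n. finite (B n) \<and> B n \<subseteq> D n"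
    and zero: "zero_fun X \<in> C\<^sub>p X closure_of (\<Union>n. B n)"
    using sel by blast
  define u where "u n f = (SOME U. U \<in> \<A> n \<and> (\<forall>x\<in>topspace X - U. f x = 1))" for n and f :: "'a \<Rightarrow> real"
  have u: "u n f \<in> \<A> n \<and> (\<forall>x\<in>topspace X - u n f. f x = 1)" if "f \<in> B n" for n f
  proof -
    have "f \<in> D n"
      using B that by blast
    then have "\<exists>U. U \<in> \<A> n \<and> (\<forall>x\<in>topspace X - U. f x = 1)"
      unfolding D_def by blast
    then show ?thesis
      unfolding u_def by (rule someI_ex)
  qed
  have catch: "\<exists>U\<in>(\<Union>n. u n ` B n). F \<subseteq> U" if F: "finite F" "F \<subseteq> topspace X" for F
  proof -
    obtain f where f: "f \<in> (\<Union>n. B n)" "\<forall>x\<in>F. \<bar>f x - zero_fun X x\<bar> < 1"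
      using C\<^sub>p_closure_approximation[OF _ zero F, of 1] by auto
    then obtain n where n: "f \<in> B n"
      by blast
    have "x \<in> u n f" if "x \<in> F" for x
    proof (rule ccontr)
      assume "x \<notin> u n f"
      then have "f x = 1"
        using u[OF n] F(2) that by blast
      moreover have "zero_fun X x = 0"
        using F(2) that by (auto simp: zero_fun_def)
      ultimately show False
        using f(2) that by auto
    qed
    then show ?thesis
      using n by blast
  qed
  have sub: "u n ` B n \<subseteq> \<A> n" for n
    using u by blast
  have "\<Union>(\<Union>n. u n ` B n) = topspace X"
  proof
    show "\<Union>(\<Union>n. u n ` B n) \<subseteq> topspace X"
      using sub openin_subset[OF A_open] by blast
    show "topspace X \<subseteq> \<Union>(\<Union>n. u n ` B n)"
    proof
      fix x
      assume "x \<in> topspace X"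
      then show "x \<in> \<Union>(\<Union>n. u n ` B n)"
        using catch[of "{x}"] by auto
    qed
  qed
  moreover have "openin X U \<and> U \<noteq> topspace X" if "U \<in> (\<Union>n. u n ` B n)" for U
    using that sub A_open A_ne by blast
  ultimately have "nontrivial_open_cover X (\<Union>n. u n ` B n)"
    unfolding nontrivial_open_cover_def by blast
  then have "(\<Union>n. u n ` B n) \<in> omega_covers X"
    unfolding omega_covers_def using catch by simp
  then show "\<exists>\<B>. (\<forall>n. finite (\<B> n) \<and> \<B> n \<subseteq> \<A> n) \<and> (\<Union>n. \<B> n) \<in> omega_covers X"
    using B sub by (intro exI[of _ "\<lambda>n. u n ` B n"]) auto
qed

section \<open>Pointwise separability\<close>

text \<open>Choose one bump function for each pair \<open>(V, W)\<close> of basic sets that admits one.\<close>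

lemma countable_isolating_family:
  assumes Y: "tychonoff_space Y" "second_countable Y"
  shows "\<exists>\<Psi>. countable \<Psi> \<and> (\<forall>\<psi>\<in>\<Psi>. continuous_map Y euclideanreal \<psi>) \<and>
    (\<forall>F y. finite F \<and> F \<subseteq> topspace Y \<and> y \<in> topspace Y - F \<longrightarrow> (\<exists>\<psi>\<in>\<Psi>. \<psi> y = 1 \<and> (\<forall>z\<in>F. \<psi> z = 0)))"
proof -
  obtain \<B> where \<B>: "countable \<B>" "\<And>V. V \<in> \<B> \<Longrightarrow> openin Y V"
    "\<And>U y. \<lbrakk>openin Y U; y \<in> U\<rbrakk> \<Longrightarrow> \<exists>V\<in>\<B>. y \<in> V \<and> V \<subseteq> U"
    using Y(2) unfolding second_countable_def by auto
  define bump where "bump V W \<psi> \<longleftrightarrow> continuous_map Y euclideanreal \<psi> \<and> (\<forall>y\<in>V. \<psi> y = 1) \<and>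
    (\<forall>y\<in>topspace Y - W. \<psi> y = 0)" for V W \<psi>
  define \<psi>0 where "\<psi>0 V W = (SOME \<psi>. bump V W \<psi>)" for V W
  have \<psi>0: "bump V W (\<psi>0 V W)" if "bump V W \<psi>" for V W \<psi>
    unfolding \<psi>0_def using that by (rule someI[of "bump V W"])
  define \<Psi> where "\<Psi> = {\<psi> \<in> (\<lambda>(V, W). \<psi>0 V W) ` (\<B> \<times> \<B>). continuous_map Y euclideanreal \<psi>}"
  have "countable ((\<lambda>(V, W). \<psi>0 V W) ` (\<B> \<times> \<B>))"
    using \<B>(1) by (intro countable_image countable_SIGMA)
  then have ctbl: "countable \<Psi>"
    by (rule countable_subset[rotated]) (auto simp: \<Psi>_def)
  have "\<exists>\<psi>\<in>\<Psi>. \<psi> y = 1 \<and> (\<forall>z\<in>F. \<psi> z = 0)"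
    if F: "finite F" "F \<subseteq> topspace Y" and y: "y \<in> topspace Y - F" for F y
  proof -
    have "closedin Y F"
      using Y(1) F by (simp add: tychonoff_space_def closedin_Hausdorff_finite)
    then have "openin Y (topspace Y - F)"
      by blast
    then obtain W where W: "W \<in> \<B>" "y \<in> W" "W \<subseteq> topspace Y - F"
      using \<B>(3)[of "topspace Y - F" y] y by blast
    have "completely_regular_space Y"
      using Y(1) by (simp add: tychonoff_space_def)
    then obtain f where f: "continuous_map Y euclideanreal f" "f y = 0" "f ` (topspace Y - W) \<subseteq> {1}"
      using W(2) \<B>(2)[OF W(1)] unfolding completely_regular_space_alt' by meson
    have "openin Y {z \<in> topspace Y. f z \<in> {..<1/2}}"
      by (rule openin_continuous_map_preimage[OF f(1)]) simp
    then obtain V where V: "V \<in> \<B>" "y \<in> V" "V \<subseteq> {z \<in> topspace Y. f z \<in> {..<1/2}}"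
      using \<B>(3)[of "{z \<in> topspace Y. f z \<in> {..<1/2}}" y] f(2) y by auto
    \<comment> \<open>Since \<open>f < 1/2\<close> on \<open>V\<close> and \<open>f = 1\<close> off \<open>W\<close>, truncating \<open>2 - 2f\<close> at \<open>1\<close> gives a bump.\<close>
    have "bump V W (\<lambda>z. min 1 (2 - 2 * f z))"
      unfolding bump_def
    proof (intro conjI ballI)
      show "continuous_map Y euclideanreal (\<lambda>z. min 1 (2 - 2 * f z))"
        using f(1) by (intro continuous_intros) auto
      show "min 1 (2 - 2 * f z) = 1" if "z \<in> V" for z
        using V(3) that by auto
      show "min 1 (2 - 2 * f z) = 0" if "z \<in> topspace Y - W" for z
        using f(3) that by (auto simp: image_subset_iff)
    qed
    then have b: "bump V W (\<psi>0 V W)"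
      by (rule \<psi>0)
    then have "\<psi>0 V W \<in> \<Psi>"
      using V(1) W(1) by (auto simp: \<Psi>_def bump_def)
    moreover have "\<psi>0 V W y = 1"
      using b V(2) by (simp add: bump_def)
    moreover have "\<forall>z\<in>F. \<psi>0 V W z = 0"
      using b W(3) F(2) unfolding bump_def by blast
    ultimately show ?thesis
      by blast
  qed
  then show ?thesis
    using ctbl by (intro exI[of _ \<Psi>]) (auto simp: \<Psi>_def)
qed

text \<open>Rational linear combinations of the isolating functions, pulled back along the condensation of
  \<open>X\<close> onto a second countable space, take prescribed rational values on any finite set, because
  the condensation is injective. The function \<open>g\<close> to be approximated may therefore be arbitrary.\<close>

lemma pointwise_dense_sequence:
  fixes X :: "'a topology"
  assumes X: "tychonoff_space X" and iw: "iw X =o natLeq"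
  obtains d :: "nat \<Rightarrow> 'a \<Rightarrow> real" where "\<And>j. d j \<in> cfun X"
    "\<And>g F e. \<lbrakk>finite F; F \<subseteq> topspace X; e > 0\<rbrakk> \<Longrightarrow> \<exists>j. \<forall>x\<in>F. \<bar>d j x - g x\<bar> < e"
proof -
  obtain Y :: "'a topology" and \<phi> where Y: "tychonoff_space Y" "second_countable Y"
    and \<phi>: "continuous_map X Y \<phi>" "inj_on \<phi> (topspace X)"
    using iw iw_countable_iff[OF X] by blast
  obtain \<Psi> where \<Psi>: "countable \<Psi> \<and> (\<forall>\<psi>\<in>\<Psi>. continuous_map Y euclideanreal \<psi>) \<and>
      (\<forall>F y. finite F \<and> F \<subseteq> topspace Y \<and> y \<in> topspace Y - F \<longrightarrow> (\<exists>\<psi>\<in>\<Psi>. \<psi> y = 1 \<and> (\<forall>z\<in>F. \<psi> z = 0)))"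
    using countable_isolating_family[OF Y] ..
  have ctbl: "countable \<Psi>"
    and cont: "\<psi> \<in> \<Psi> \<Longrightarrow> continuous_map Y euclideanreal \<psi>"
    and iso: "\<lbrakk>finite F; F \<subseteq> topspace Y; y \<in> topspace Y; y \<notin> F\<rbrakk> \<Longrightarrow>
      \<exists>\<psi>\<in>\<Psi>. \<psi> y = 1 \<and> (\<forall>z\<in>F. \<psi> z = 0)" for \<psi> F y
    using \<Psi> by simp_all
  define comb where "comb l = restrict (\<lambda>x. \<Sum>(q, \<psi>)\<leftarrow>l. q * \<psi> (\<phi> x)) (topspace X)"
    for l :: "(real \<times> ('a \<Rightarrow> real)) list"
  define S where "S = comb ` lists (\<rat> \<times> \<Psi>)"
  have "countable S"
    unfolding S_def using ctbl by (intro countable_image countable_lists countable_SIGMA countable_rat)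
  have "continuous_map X euclideanreal (\<lambda>x. \<Sum>(q, \<psi>)\<leftarrow>l. q * \<psi> (\<phi> x))" if "l \<in> lists (\<rat> \<times> \<Psi>)" for l
    using that
  proof (induction l)
    case (Cons p l)
    then obtain q \<psi> where p: "p = (q, \<psi>)" "\<psi> \<in> \<Psi>"
      by auto
    have "continuous_map X euclideanreal (\<psi> \<circ> \<phi>)"
      using \<phi>(1) cont[OF p(2)] by (rule continuous_map_compose)
    then show ?case
      using Cons.IH by (simp add: p(1) o_def continuous_map_add continuous_map_real_mult_left)
  qed simp
  then have S_cfun: "S \<subseteq> cfun X"
    unfolding S_def comb_def using restrict_in_cfun by blast
  have approx: "\<exists>f\<in>S. \<forall>x\<in>F. \<bar>f x - g x\<bar> < e"
    if F: "finite F" "F \<subseteq> topspace X" and e: "e > 0" for g :: "'a \<Rightarrow> real" and F e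
  proof -
    have "\<exists>\<psi>\<in>\<Psi>. \<psi> (\<phi> x) = 1 \<and> (\<forall>z\<in>F - {x}. \<psi> (\<phi> z) = 0)" if x: "x \<in> F" for x
    proof -
      have "\<phi> ` topspace X \<subseteq> topspace Y"
        using \<phi>(1) by (simp add: continuous_map_image_subset_topspace)
      then have "\<phi> ` (F - {x}) \<subseteq> topspace Y" "\<phi> x \<in> topspace Y"
        using F(2) x by blast+
      moreover have "\<phi> x \<notin> \<phi> ` (F - {x})"
        using \<phi>(2) F(2) x by (auto simp: inj_on_def)
      ultimately show ?thesis
        using iso[of "\<phi> ` (F - {x})" "\<phi> x"] F(1) by auto
    qed
    then obtain \<psi> where \<psi>: "\<And>x. x \<in> F \<Longrightarrow> \<psi> x \<in> \<Psi> \<and> \<psi> x (\<phi> x) = 1 \<and> (\<forall>z\<in>F - {x}. \<psi> x (\<phi> z) = 0)"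
      by metis
    have "\<exists>q\<in>\<rat>. \<bar>q - g x\<bar> < e" for x
    proof -
      obtain r where "r \<in> \<rat>" "g x - e < r" "r < g x + e"
        using Rats_dense_in_real[of "g x - e" "g x + e"] e by auto
      then show ?thesis
        by (intro bexI[of _ r]) (auto simp: abs_less_iff)
    qed
    then obtain q where q: "\<And>x. q x \<in> \<rat> \<and> \<bar>q x - g x\<bar> < e"
      by metis
    obtain xs where xs: "set xs = F" "distinct xs"
      using F(1) finite_distinct_list by blast
    define l where "l = map (\<lambda>x. (q x, \<psi> x)) xs"
    have l: "l \<in> lists (\<rat> \<times> \<Psi>)"
      using xs(1) q \<psi> by (auto simp: l_def)
    have "comb l z = q z" if z: "z \<in> F" for z
    proof -
      have "comb l z = (\<Sum>x\<leftarrow>xs. q x * \<psi> x (\<phi> z))"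
        using z F(2) by (auto simp: comb_def l_def o_def)
      also have "\<dots> = (\<Sum>x\<in>F. q x * \<psi> x (\<phi> z))"
        using xs by (simp add: sum_list_distinct_conv_sum_set)
      also have "\<dots> = (\<Sum>x\<in>F. if x = z then q x else 0)"
        using \<psi> z by (intro sum.cong) auto
      also have "\<dots> = q z"
        using F(1) z by simp
      finally show ?thesis .
    qed
    then show ?thesis
      using l q unfolding S_def by (intro bexI[of _ "comb l"]) auto
  qed
  have "S \<noteq> {}"
    unfolding S_def by auto
  then have S: "range (from_nat_into S) = S"
    using \<open>countable S\<close> by (rule range_from_nat_into)
  show thesis
  proof (rule that[of "from_nat_into S"])
    show "from_nat_into S j \<in> cfun X" for j
      using S S_cfun by blast
    show "\<exists>j. \<forall>x\<in>F. \<bar>from_nat_into S j x - g x\<bar> < e"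
      if "finite F" "F \<subseteq> topspace X" "e > 0" for g F e
      using approx[OF that, of g] S by (metis rangeE)
  qed
qed

section \<open>From covers to games on function spaces\<close>

lemma dense_C\<^sub>k_approximation:
  assumes "A \<in> dense_sets (C\<^sub>k X)" "g \<in> cfun X" "finite F" "F \<subseteq> topspace X" "e > 0"
  shows "\<exists>f\<in>A. \<forall>x\<in>F. \<bar>f x - g x\<bar> < e"
  using assms C\<^sub>k_closure_approximation[of X g A F e] by (simp add: dense_sets_def topspace_C\<^sub>k)

lemma zero_in_C\<^sub>p_closureI:
  assumes A: "A \<subseteq> cfun X" and catch: "\<And>q F. \<lbrakk>finite F; F \<subseteq> topspace X\<rbrakk> \<Longrightarrow>
      \<exists>f\<in>A. F \<subseteq> {x \<in> topspace X. \<bar>f x - zero_fun X x\<bar> < 1 / real (Suc q)}"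
  shows "zero_fun X \<in> C\<^sub>p X closure_of A"
proof (rule in_C\<^sub>p_closureI[OF zero_fun_in_cfun A])
  fix F and e :: real
  assume F: "finite F" "F \<subseteq> topspace X" and "e > 0"
  then obtain q where q: "1 / real (Suc q) < e"
    using nat_approx_posE by blast
  obtain f where "f \<in> A" "F \<subseteq> {x \<in> topspace X. \<bar>f x - zero_fun X x\<bar> < 1 / real (Suc q)}"
    using catch[OF F] by blast
  then show "\<exists>f\<in>A. \<forall>x\<in>F. \<bar>f x - zero_fun X x\<bar> < e"
    using q by (intro bexI[of _ f]) (auto intro: less_trans)
qed

lemma no_strategy_k_omega:
  assumes "omega_menger X"
  shows "\<not> ONE_has_winning_strategy_G_fin (k_covers X) (omega_covers X)"
proof (rule ONE_has_no_winning_strategyI)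
  fix \<sigma>
  assume \<sigma>: "strategy_ONE (k_covers X) \<sigma>"
  have "open_omega_family X ((\<lambda>U. U) ` \<A>)" if "\<A> \<in> k_covers X" for \<A>
    using k_cover_is_open_omega_family[OF that] by simp
  from TWO_beats_strategy[OF assms \<sigma>, of "\<lambda>\<A>. \<A>" "\<lambda>q U. U", OF order_refl this]
  obtain B where "(\<forall>n. finite (B n) \<and> B n \<subseteq> \<sigma> (map B [0..<n]) \<and> \<sigma> (map B [0..<n]) \<in> k_covers X) \<and>
      (\<forall>(q :: nat) F. finite F \<and> F \<subseteq> topspace X \<longrightarrow> (\<exists>n. \<exists>U\<in>B n. F \<subseteq> U))" ..
  then have B: "finite (B n)" "B n \<subseteq> \<sigma> (map B [0..<n])" "\<sigma> (map B [0..<n]) \<in> k_covers X"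
    and catch: "\<lbrakk>finite F; F \<subseteq> topspace X\<rbrakk> \<Longrightarrow> \<exists>n. \<exists>U\<in>B n. F \<subseteq> U" for n F
    by simp_all
  have mem: "openin X U \<and> U \<noteq> topspace X" if "U \<in> B n" for U n
  proof -
    have "U \<in> \<sigma> (map B [0..<n])"
      using B(2) that by blast
    then show ?thesis
      using B(3)[of n] by (auto simp: k_covers_def nontrivial_open_cover_def)
  qed
  have "\<Union>(\<Union>n. B n) = topspace X"
  proof
    show "\<Union>(\<Union>n. B n) \<subseteq> topspace X"
      using mem openin_subset by blast
    show "topspace X \<subseteq> \<Union>(\<Union>n. B n)"
    proof
      fix x
      assume "x \<in> topspace X"
      then show "x \<in> \<Union>(\<Union>n. B n)"
        using catch[of "{x}"] by auto
    qed
  qed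
  then have "nontrivial_open_cover X (\<Union>n. B n)"
    unfolding nontrivial_open_cover_def using mem by blast
  then have "(\<Union>n. B n) \<in> omega_covers X"
    unfolding omega_covers_def using catch by simp
  then show "\<exists>B. (\<forall>n. finite (B n) \<and> B n \<subseteq> \<sigma> (map B [0..<n])) \<and> (\<Union>n. B n) \<in> omega_covers X"
    using B(1,2) by blast
qed

lemma no_strategy_zero:
  assumes menger: "omega_menger X"
    and A: "\<And>A. A \<in> \<A> \<Longrightarrow> A \<subseteq> cfun X"
    and near: "\<And>A F e. \<lbrakk>A \<in> \<A>; finite F; F \<subseteq> topspace X; e > (0 :: real)\<rbrakk> \<Longrightarrow>
      \<exists>f\<in>A - {zero_fun X}. \<forall>x\<in>F. \<bar>f x - zero_fun X x\<bar> < e"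
  shows "\<not> ONE_has_winning_strategy_G_fin \<A> (Omega_at (C\<^sub>p X) (zero_fun X))"
proof (rule ONE_has_no_winning_strategyI)
  fix \<sigma>
  assume \<sigma>: "strategy_ONE \<A> \<sigma>"
  let ?U = "\<lambda>(q :: nat) f. {x \<in> topspace X. \<bar>f x - zero_fun X x\<bar> < 1 / real (Suc q)}"
  have fam: "open_omega_family X (?U q ` (A - {zero_fun X}))" if "A \<in> \<A>" for A q
    using A[OF that] near[OF that] by (intro approximating_family) (auto simp: zero_fun_in_cfun)
  from TWO_beats_strategy[OF menger \<sigma>, of "\<lambda>A. A - {zero_fun X}" ?U, OF Diff_subset fam]
  obtain B where "(\<forall>n. finite (B n) \<and> B n \<subseteq> \<sigma> (map B [0..<n]) - {zero_fun X} \<and> \<sigma> (map B [0..<n]) \<in> \<A>) \<and>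
      (\<forall>q F. finite F \<and> F \<subseteq> topspace X \<longrightarrow> (\<exists>n. \<exists>f\<in>B n. F \<subseteq> ?U q f))" ..
  then have B: "finite (B n)" "B n \<subseteq> \<sigma> (map B [0..<n]) - {zero_fun X}" "\<sigma> (map B [0..<n]) \<in> \<A>"
    and catch: "\<lbrakk>finite F; F \<subseteq> topspace X\<rbrakk> \<Longrightarrow> \<exists>n. \<exists>f\<in>B n. F \<subseteq> ?U q f" for n q F
    by simp_all
  have sub: "(\<Union>n. B n) \<subseteq> cfun X"
    using B(2) A[OF B(3)] by blast
  have "\<exists>f\<in>\<Union>n. B n. F \<subseteq> ?U q f" if "finite F" "F \<subseteq> topspace X" for q F
    using catch[OF that, of q] by blast
  then have "zero_fun X \<in> C\<^sub>p X closure_of (\<Union>n. B n)"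
    by (rule zero_in_C\<^sub>p_closureI[OF sub])
  then have "(\<Union>n. B n) \<in> Omega_at (C\<^sub>p X) (zero_fun X)"
    using sub B(2) unfolding Omega_at_def topspace_C\<^sub>p by blast
  then show "\<exists>B. (\<forall>n. finite (B n) \<and> B n \<subseteq> \<sigma> (map B [0..<n])) \<and>
      (\<Union>n. B n) \<in> Omega_at (C\<^sub>p X) (zero_fun X)"
    using B(1,2) by blast
qed

lemma no_strategy_Omega_Omega:
  assumes "omega_menger X"
  shows "\<not> ONE_has_winning_strategy_G_fin
    (Omega_at (C\<^sub>k X) (zero_fun X)) (Omega_at (C\<^sub>p X) (zero_fun X))"
proof (rule no_strategy_zero[OF assms])
  fix A
  assume A: "A \<in> Omega_at (C\<^sub>k X) (zero_fun X)"
  then show "A \<subseteq> cfun X"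
    by (simp add: Omega_at_def topspace_C\<^sub>k)
  fix F and e :: real
  assume "finite F" "F \<subseteq> topspace X" "e > 0"
  then show "\<exists>f\<in>A - {zero_fun X}. \<forall>x\<in>F. \<bar>f x - zero_fun X x\<bar> < e"
    using A C\<^sub>k_closure_approximation[of X "zero_fun X" A F e] by (simp add: Omega_at_def)
qed

text \<open>A dense set may contain the zero function, which TWO must not pick. Approximating the constant
  \<open>e / 2\<close> within \<open>e / 2\<close> gives a function that is positive, hence nonzero, and below \<open>e\<close>; for
  positivity to say something a point \<open>x0\<close> is needed.\<close>

lemma no_strategy_dense_Omega:
  assumes menger: "omega_menger X" and "topspace X \<noteq> {}"
  shows "\<not> ONE_has_winning_strategy_G_fin (dense_sets (C\<^sub>k X)) (Omega_at (C\<^sub>p X) (zero_fun X))"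
proof (rule no_strategy_zero[OF menger])
  fix A
  assume A: "A \<in> dense_sets (C\<^sub>k X)"
  then show "A \<subseteq> cfun X"
    by (simp add: dense_sets_def topspace_C\<^sub>k)
  fix F and e :: real
  assume F: "finite F" "F \<subseteq> topspace X" and e: "e > 0"
  obtain x0 where x0: "x0 \<in> topspace X"
    using assms(2) by blast
  have "restrict (\<lambda>x. e / 2) (topspace X) \<in> cfun X"
    by (rule restrict_in_cfun) simp
  then obtain f where f: "f \<in> A"
    "\<forall>x\<in>insert x0 F. \<bar>f x - restrict (\<lambda>x. e / 2) (topspace X) x\<bar> < e / 2"
    using dense_C\<^sub>k_approximation[OF A, of "restrict (\<lambda>x. e / 2) (topspace X)" "insert x0 F" "e / 2"]
      F x0 e by auto
  have pos: "0 < f x \<and> f x < e" if "x \<in> insert x0 F" for x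
  proof -
    have "x \<in> topspace X"
      using that F(2) x0 by blast
    then have "\<bar>f x - e / 2\<bar> < e / 2"
      using f(2) that by fastforce
    then show ?thesis
      unfolding abs_less_iff by (auto simp: field_simps)
  qed
  have "f \<noteq> zero_fun X"
    using pos[of x0] x0 by (auto simp: zero_fun_def)
  moreover have "\<bar>f x - zero_fun X x\<bar> < e" if "x \<in> F" for x
  proof -
    have "x \<in> topspace X" "0 < f x" "f x < e"
      using that F(2) pos[of x] by auto
    then show ?thesis
      by (simp add: zero_fun_def)
  qed
  ultimately show "\<exists>f\<in>A - {zero_fun X}. \<forall>x\<in>F. \<bar>f x - zero_fun X x\<bar> < e"
    using f(1) by blast
qed

text \<open>To make a set pointwise dense it suffices to approximate the members of a pointwise dense
  sequence, so TWO has only countably many (function, precision) pairs to serve; these are coded by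
  the index \<open>q\<close>.\<close>

lemma no_strategy_dense_dense:
  assumes menger: "omega_menger X" and X: "tychonoff_space X" "iw X =o natLeq"
  shows "\<not> ONE_has_winning_strategy_G_fin (dense_sets (C\<^sub>k X)) (dense_sets (C\<^sub>p X))"
proof (rule ONE_has_no_winning_strategyI)
  fix \<sigma>
  assume \<sigma>: "strategy_ONE (dense_sets (C\<^sub>k X)) \<sigma>"
  obtain d :: "nat \<Rightarrow> 'a \<Rightarrow> real" where d: "\<And>j. d j \<in> cfun X"
    and d_dense: "\<And>g F e. \<lbrakk>finite F; F \<subseteq> topspace X; e > 0\<rbrakk> \<Longrightarrow> \<exists>j. \<forall>x\<in>F. \<bar>d j x - g x\<bar> < e"
    using pointwise_dense_sequence[OF X] by blast
  let ?U = "\<lambda>q f. {x \<in> topspace X. \<bar>f x - d (fst (prod_decode q)) x\<bar> < 1 / real (Suc (snd (prod_decode q)))}"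
  have fam: "open_omega_family X (?U q ` A)" if A: "A \<in> dense_sets (C\<^sub>k X)" for A q
    using A d dense_C\<^sub>k_approximation[OF A d]
    by (intro approximating_family) (auto simp: dense_sets_def topspace_C\<^sub>k)
  from TWO_beats_strategy[OF menger \<sigma>, of "\<lambda>A. A" ?U, OF order_refl fam]
  obtain B where "(\<forall>n. finite (B n) \<and> B n \<subseteq> \<sigma> (map B [0..<n]) \<and> \<sigma> (map B [0..<n]) \<in> dense_sets (C\<^sub>k X)) \<and>
      (\<forall>q F. finite F \<and> F \<subseteq> topspace X \<longrightarrow> (\<exists>n. \<exists>f\<in>B n. F \<subseteq> ?U q f))" ..
  then have B: "finite (B n)" "B n \<subseteq> \<sigma> (map B [0..<n])" "\<sigma> (map B [0..<n]) \<in> dense_sets (C\<^sub>k X)"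
    and catch: "\<lbrakk>finite F; F \<subseteq> topspace X\<rbrakk> \<Longrightarrow> \<exists>n. \<exists>f\<in>B n. F \<subseteq> ?U q f" for n q F
    by simp_all
  have "\<sigma> (map B [0..<n]) \<subseteq> cfun X" for n
    using B(3)[of n] by (simp add: dense_sets_def topspace_C\<^sub>k)
  then have sub: "(\<Union>n. B n) \<subseteq> cfun X"
    using B(2) by blast
  have "g \<in> C\<^sub>p X closure_of (\<Union>n. B n)" if g: "g \<in> cfun X" for g
  proof (rule in_C\<^sub>p_closureI[OF g sub])
    fix F and e :: real
    assume F: "finite F" "F \<subseteq> topspace X" and "e > 0"
    then have "e / 2 > 0"
      by simp
    then obtain m where m: "1 / real (Suc m) < e / 2"
      using nat_approx_posE by blast
    obtain j where j: "\<forall>x\<in>F. \<bar>d j x - g x\<bar> < e / 2"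
      using d_dense[OF F \<open>e / 2 > 0\<close>] by blast
    obtain n f where f: "f \<in> B n" "F \<subseteq> ?U (prod_encode (j, m)) f"
      using catch[OF F, of "prod_encode (j, m)"] by blast
    have "\<bar>f x - g x\<bar> < e" if x: "x \<in> F" for x
    proof -
      have "\<bar>f x - d j x\<bar> < 1 / real (Suc m)"
        using f(2) x by auto
      moreover have "\<bar>d j x - g x\<bar> < e / 2"
        using j x by blast
      ultimately show ?thesis
        using m by linarith
    qed
    then show "\<exists>f\<in>\<Union>n. B n. \<forall>x\<in>F. \<bar>f x - g x\<bar> < e"
      using f(1) by blast
  qed
  then have "(\<Union>n. B n) \<in> dense_sets (C\<^sub>p X)"
    using sub closure_of_subset_topspace[of "C\<^sub>p X" "\<Union>n. B n"]
    unfolding dense_sets_def topspace_C\<^sub>p by blast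
  then show "\<exists>B. (\<forall>n. finite (B n) \<and> B n \<subseteq> \<sigma> (map B [0..<n])) \<and> (\<Union>n. B n) \<in> dense_sets (C\<^sub>p X)"
    using B(1,2) by blast
qed

section \<open>The equivalences\<close>

theorem theorem4p2:
  fixes X :: "'a topology"
  assumes "tychonoff_space X"
    and "topspace X \<noteq> {}"
    and "iw X =o natLeq"
  shows "all_equivalent
    [S_fin (dense_sets (C\<^sub>k X)) (dense_sets (C\<^sub>p X)),
     S_fin (dense_sets (C\<^sub>k X)) (Omega_at (C\<^sub>p X) (zero_fun X)),
     S_fin (Omega_at (C\<^sub>k X) (zero_fun X)) (Omega_at (C\<^sub>p X) (zero_fun X)),
     S_fin (k_covers X) (omega_covers X),
     \<not> ONE_has_winning_strategy_G_fin (k_covers X) (omega_covers X),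
     \<not> ONE_has_winning_strategy_G_fin (dense_sets (C\<^sub>k X)) (dense_sets (C\<^sub>p X)),
     \<not> ONE_has_winning_strategy_G_fin
         (Omega_at (C\<^sub>k X) (zero_fun X)) (Omega_at (C\<^sub>p X) (zero_fun X)),
     \<not> ONE_has_winning_strategy_G_fin
         (dense_sets (C\<^sub>k X)) (Omega_at (C\<^sub>p X) (zero_fun X))]"
proof -
  note X = assms(1) and ne = assms(2) and iw = assms(3)
  have reg: "completely_regular_space X"
    using X by (simp add: tychonoff_space_def)
  have from_function_space: "S_fin (k_covers X) (omega_covers X)"
    if S: "S_fin \<A> \<B>"
      and A: "\<And>D. D \<in> dense_sets (C\<^sub>k X) \<Longrightarrow> zero_fun X \<notin> D \<Longrightarrow> D \<in> \<A>"
      and B: "\<And>D. D \<in> \<B> \<Longrightarrow> zero_fun X \<in> C\<^sub>p X closure_of D" for \<A> \<B>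
  proof (rule S_fin_k_omega_from_C\<^sub>k[OF reg])
    fix D :: "nat \<Rightarrow> ('a \<Rightarrow> real) set"
    assume "\<And>n. D n \<in> dense_sets (C\<^sub>k X)" "\<And>n. zero_fun X \<notin> D n"
    then have "\<forall>n. D n \<in> \<A>"
      using A by blast
    then show "\<exists>B. (\<forall>n. finite (B n) \<and> B n \<subseteq> D n) \<and> zero_fun X \<in> C\<^sub>p X closure_of (\<Union>n. B n)"
      using S B unfolding S_fin_def by blast
  qed
  let ?Dk = "dense_sets (C\<^sub>k X)" and ?Dp = "dense_sets (C\<^sub>p X)"
    and ?Ok = "Omega_at (C\<^sub>k X) (zero_fun X)" and ?Op = "Omega_at (C\<^sub>p X) (zero_fun X)"
  let ?S = "S_fin (k_covers X) (omega_covers X)"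
  have menger: "omega_menger X" if ?S
    using that by (rule S_fin_k_omega_imp_omega_menger)
  have S_dense_dense: "S_fin ?Dk ?Dp \<Longrightarrow> ?S"
    by (erule from_function_space) (auto simp: dense_sets_def topspace_C\<^sub>p zero_fun_in_cfun)
  have S_dense_Omega: "S_fin ?Dk ?Op \<Longrightarrow> ?S"
    by (erule from_function_space) (auto simp: Omega_at_def)
  have S_Omega_Omega: "S_fin ?Ok ?Op \<Longrightarrow> ?S"
    by (erule from_function_space) (auto simp: Omega_at_def dense_sets_def topspace_C\<^sub>k zero_fun_in_cfun)
  have "S_fin ?Dk ?Dp = ?S" "(\<not> ONE_has_winning_strategy_G_fin ?Dk ?Dp) = ?S"
    using S_dense_dense no_strategy_dense_dense[OF menger X iw]
      S_fin_if_ONE_has_no_winning_strategy[of ?Dk ?Dp] by blast+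
  moreover have "S_fin ?Dk ?Op = ?S" "(\<not> ONE_has_winning_strategy_G_fin ?Dk ?Op) = ?S"
    using S_dense_Omega no_strategy_dense_Omega[OF menger ne]
      S_fin_if_ONE_has_no_winning_strategy[of ?Dk ?Op] by blast+
  moreover have "S_fin ?Ok ?Op = ?S" "(\<not> ONE_has_winning_strategy_G_fin ?Ok ?Op) = ?S"
    using S_Omega_Omega no_strategy_Omega_Omega[OF menger]
      S_fin_if_ONE_has_no_winning_strategy[of ?Ok ?Op] by blast+
  moreover have "(\<not> ONE_has_winning_strategy_G_fin (k_covers X) (omega_covers X)) = ?S"
    using no_strategy_k_omega[OF menger]
      S_fin_if_ONE_has_no_winning_strategy[of "k_covers X" "omega_covers X"] by blast
  ultimately show ?thesis
    unfolding all_equivalent_def by simp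
qed

end
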